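(* Let $\alpha$ be a weak composition and $\varphi$ a flag. If $\varphi$ is strictly increasing, then $\kappa_{(\alpha,\varphi)}=\kappa_\beta$, where $\beta_j=\alpha_i$ if $\varphi(i)=j$ for some $i$, and $\beta_j=0$ otherwise. If $\varphi$ is not strictly increasing and $i$ is the smallest index with $\varphi(i)=\varphi(i+1)$, then $$\kappa_{(\alpha,\varphi)}=\begin{cases}\kappa_{(\alpha,\varphi-\mathbf e_i)}&\text{if }\alpha_i\le\alpha_{i+1},\\ \kappa_{(\alpha\cdot s_i,\varphi-\mathbf e_i)}&\text{if }\alpha_i>\alpha_{i+1}.\end{cases}$$
   Context: Tableaux: fillings by positive integers of finite sets of boxes (row $r$, column $c\in\mathbb{Z}_{>0}$), rows left-justified, rows indexed upward; $T_{rc}$ is an entry; shape = weak composition of row lengths. $\mathsf{wt}(T)=(\beta_1,\beta_2,\dots)$ with $\beta_i$ the number of entries equal to $i$. A flag is a weakly increasing $\varphi:\mathbb{Z}_{>0}\to\mathbb{Z}_{>0}$ with $\varphi(m)\ge m$; $(\varphi-\mathbf e_i)(l)=\varphi(l)-\delta_{il}$. A key tableau: (a) rows weakly decreasing left to right; (b) columns with distinct entries; (c) if boxes $(i,j),(k,j)$ with $i<k$ have $T_{ij}>T_{kj}$ then $(i,j+1)$ is a box with $T_{i,j+1}>T_{kj}$. $\varphi$-flagged: $T_{ij}\le\varphi(i)$ for all boxes. $\mathrm{SSKT}(\alpha,\varphi)$: $\varphi$-flagged key tableaux of shape $\alpha$; $\kappa_{(\alpha,\varphi)}=\sum_{T\in\mathrm{SSKT}(\alpha,\varphi)}x^{\mathsf{wt}(T)}$.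 Key polynomials: $\pi_if=\partial_i(x_if)$, $\partial_if=(f-s_if)/(x_i-x_{i+1})$; $\pi_w=\pi_{i_1}\cdots\pi_{i_m}$ for a reduced word of $w$; $\alpha\cdot s_i$ swaps $\alpha_i$ and $\alpha_{i+1}$; $\kappa_\alpha=\pi_wx^\lambda$ with $w$ of minimal length such that $\alpha\cdot w=\lambda$ is a partition. *)

theory Defs
  imports
    "HOL-Library.Poly_Mapping"
    "HOL-Library.FuncSet"
    "HOL-Combinatorics.Permutations"
begin

text \<open>
  All indices (rows, columns, entries, variables) are positive integers. They are represented by
  natural numbers; the index 0 is never used. In particular a weak composition is a
  finitely supported function whose value at 0 is 0, and the value of a flag at 0 is irrelevant.
\<close>

type_synonym comp = "nat \<Rightarrow>\<^sub>0 nat"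

definition weak_composition :: "comp \<Rightarrow> bool" where
  "weak_composition \<alpha> \<longleftrightarrow> Poly_Mapping.lookup \<alpha> 0 = 0"

definition is_partition :: "comp \<Rightarrow> bool" where
  "is_partition \<alpha> \<longleftrightarrow> weak_composition \<alpha> \<and>
     (\<forall>i j. 1 \<le> i \<longrightarrow> i \<le> j \<longrightarrow> Poly_Mapping.lookup \<alpha> j \<le> Poly_Mapping.lookup \<alpha> i)"

definition flag :: "(nat \<Rightarrow> nat) \<Rightarrow> bool" where
  "flag \<phi> \<longleftrightarrow> mono_on {1..} \<phi> \<and> (\<forall>m\<ge>1. \<phi> m \<ge> m)"

definition flag_minus_e :: "(nat \<Rightarrow> nat) \<Rightarrow> nat \<Rightarrow> nat \<Rightarrow> nat" where
  "flag_minus_e \<phi> i = (\<lambda>l. \<phi> l - (if l = i then 1 else 0))"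

definition simple_transp :: "nat \<Rightarrow> nat \<Rightarrow> nat" where
  "simple_transp i = transpose i (i + 1)"

text \<open>
  The right action: the \<open>j\<close>-th part of \<open>\<alpha> \<cdot> w\<close> is the \<open>w j\<close>-th part of \<open>\<alpha>\<close>
  (for injective \<open>w\<close>), so that \<open>(\<alpha> \<cdot> u) \<cdot> v = \<alpha> \<cdot> (u \<circ> v)\<close>.
\<close>

definition comp_act :: "comp \<Rightarrow> (nat \<Rightarrow> nat) \<Rightarrow> comp" where
  "comp_act \<alpha> w = Poly_Mapping.map_key w \<alpha>"


subsection \<open>Polynomials in \<open>x\<^sub>1, x\<^sub>2, \<dots>\<close>\<close>

text \<open>
  A polynomial maps exponent vectors to coefficients; the multiplication of
  \<^typ>\<open>(nat \<Rightarrow>\<^sub>0 nat) \<Rightarrow>\<^sub>0 int\<close> is the usual (convolution) product.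
\<close>

type_synonym ipoly = "(nat \<Rightarrow>\<^sub>0 nat) \<Rightarrow>\<^sub>0 int"

definition monomial :: "comp \<Rightarrow> ipoly" where
  "monomial \<beta> = Poly_Mapping.single \<beta> 1"

definition var :: "nat \<Rightarrow> ipoly" where
  "var i = monomial (Poly_Mapping.single i 1)"

text \<open>Exchanging \<open>x\<^sub>i\<close> and \<open>x\<^sub>i\<^sub>+\<^sub>1\<close>: the coefficient of \<open>x\<^sup>\<beta>\<close> in \<open>s\<^sub>i f\<close> is that of \<open>x\<close> to the \<open>\<beta> \<cdot> s\<^sub>i\<close> in \<open>f\<close>.\<close>

definition swap_vars :: "nat \<Rightarrow> ipoly \<Rightarrow> ipoly" where
  "swap_vars i f = Poly_Mapping.map_key (\<lambda>\<beta>. comp_act \<beta> (simple_transp i)) f"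

text \<open>The quotient \<open>(f - s\<^sub>i f) / (x\<^sub>i - x\<^sub>i\<^sub>+\<^sub>1)\<close> in the integral domain of polynomials.\<close>

definition divided_diff :: "nat \<Rightarrow> ipoly \<Rightarrow> ipoly" where
  "divided_diff i f = (THE g. (var i - var (i + 1)) * g = f - swap_vars i f)"

definition pi_op :: "nat \<Rightarrow> ipoly \<Rightarrow> ipoly" where
  "pi_op i f = divided_diff i (var i * f)"


subsection \<open>Words, reduced words and key polynomials\<close>

definition perm_of_word :: "nat list \<Rightarrow> nat \<Rightarrow> nat" where
  "perm_of_word is = foldr (\<lambda>i w. simple_transp i \<circ> w) is id"

definition word_of :: "(nat \<Rightarrow> nat) \<Rightarrow> nat list \<Rightarrow> bool" where
  "word_of w is \<longleftrightarrow> set is \<subseteq> {1..} \<and> perm_of_word is = w"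

definition perm_length :: "(nat \<Rightarrow> nat) \<Rightarrow> nat" where
  "perm_length w = (LEAST m. \<exists>is. word_of w is \<and> length is = m)"

definition reduced_word :: "(nat \<Rightarrow> nat) \<Rightarrow> nat list \<Rightarrow> bool" where
  "reduced_word w is \<longleftrightarrow> word_of w is \<and> length is = perm_length w"

definition pi_perm :: "(nat \<Rightarrow> nat) \<Rightarrow> ipoly \<Rightarrow> ipoly" where
  "pi_perm w = foldr pi_op (SOME is. reduced_word w is)"

definition key_perm :: "comp \<Rightarrow> nat \<Rightarrow> nat" where
  "key_perm \<alpha> = arg_min perm_length
     (\<lambda>w. (\<exists>n. w permutes {1..n}) \<and> is_partition (comp_act \<alpha> w))"

definition key_poly :: "comp \<Rightarrow> ipoly" where
  "key_poly \<alpha> = pi_perm (key_perm \<alpha>) (monomial (comp_act \<alpha> (key_perm \<alpha>)))"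


subsection \<open>Flagged key tableaux\<close>

definition boxes :: "comp \<Rightarrow> (nat \<times> nat) set" where
  "boxes \<alpha> = {(r, c). 1 \<le> r \<and> 1 \<le> c \<and> c \<le> Poly_Mapping.lookup \<alpha> r}"

definition tableaux :: "comp \<Rightarrow> (nat \<times> nat \<Rightarrow> nat) set" where
  "tableaux \<alpha> = boxes \<alpha> \<rightarrow>\<^sub>E {1..}"

definition tab_wt :: "comp \<Rightarrow> (nat \<times> nat \<Rightarrow> nat) \<Rightarrow> comp" where
  "tab_wt \<alpha> T = Abs_poly_mapping (\<lambda>i. card {b \<in> boxes \<alpha>. T b = i})"

definition key_tableau :: "comp \<Rightarrow> (nat \<times> nat \<Rightarrow> nat) \<Rightarrow> bool" where
  "key_tableau \<alpha> T \<longleftrightarrow> T \<in> tableaux \<alpha> \<and>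
     (\<forall>i j. (i, j) \<in> boxes \<alpha> \<longrightarrow> (i, j + 1) \<in> boxes \<alpha> \<longrightarrow> T (i, j) \<ge> T (i, j + 1)) \<and>
     (\<forall>i k j. (i, j) \<in> boxes \<alpha> \<longrightarrow> (k, j) \<in> boxes \<alpha> \<longrightarrow> i \<noteq> k \<longrightarrow> T (i, j) \<noteq> T (k, j)) \<and>
     (\<forall>i k j. (i, j) \<in> boxes \<alpha> \<longrightarrow> (k, j) \<in> boxes \<alpha> \<longrightarrow> i < k \<longrightarrow> T (i, j) > T (k, j) \<longrightarrow>
        (i, j + 1) \<in> boxes \<alpha> \<and> T (i, j + 1) > T (k, j))"

definition flagged :: "comp \<Rightarrow> (nat \<Rightarrow> nat) \<Rightarrow> (nat \<times> nat \<Rightarrow> nat) \<Rightarrow> bool" where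
  "flagged \<alpha> \<phi> T \<longleftrightarrow> (\<forall>i j. (i, j) \<in> boxes \<alpha> \<longrightarrow> T (i, j) \<le> \<phi> i)"

definition SSKT :: "comp \<Rightarrow> (nat \<Rightarrow> nat) \<Rightarrow> (nat \<times> nat \<Rightarrow> nat) set" where
  "SSKT \<alpha> \<phi> = {T. key_tableau \<alpha> T \<and> flagged \<alpha> \<phi> T}"

definition flagged_key_poly :: "comp \<Rightarrow> (nat \<Rightarrow> nat) \<Rightarrow> ipoly" where
  "flagged_key_poly \<alpha> \<phi> = (\<Sum>T\<in>SSKT \<alpha> \<phi>. monomial (tab_wt \<alpha> T))"

definition flag_comp :: "comp \<Rightarrow> (nat \<Rightarrow> nat) \<Rightarrow> comp" where
  "flag_comp \<alpha> \<phi> = Abs_poly_mapping (\<lambda>j.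
     if \<exists>i\<ge>1. \<phi> i = j then Poly_Mapping.lookup \<alpha> (THE i. i \<ge> 1 \<and> \<phi> i = j) else 0)"


subsection \<open>Well-definedness\<close>

lemma lookup_comp_act:
  "inj w \<Longrightarrow> Poly_Mapping.lookup (comp_act \<alpha> w) j = Poly_Mapping.lookup \<alpha> (w j)"
  by (simp add: comp_act_def map_key.rep_eq)

lemma lookup_swap_vars:
  "Poly_Mapping.lookup (swap_vars i f) \<beta> = Poly_Mapping.lookup f (comp_act \<beta> (simple_transp i))"
proof -
  have inj: "inj (simple_transp i)"
    by (simp add: simple_transp_def)
  have "comp_act (comp_act \<beta> (simple_transp i)) (simple_transp i) = \<beta>" for \<beta>
    by (rule poly_mapping_eqI) (simp add: lookup_comp_act[OF inj], simp add: simple_transp_def)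
  then have "inj (\<lambda>\<beta>. comp_act \<beta> (simple_transp i))"
    by (rule inj_on_inverseI)
  then show ?thesis
    by (simp add: swap_vars_def map_key.rep_eq)
qed

lemma finite_boxes: "finite (boxes \<alpha>)"
proof (rule finite_subset)
  show "boxes \<alpha> \<subseteq> (SIGMA r:Poly_Mapping.keys \<alpha>. {..Poly_Mapping.lookup \<alpha> r})"
    by (auto simp: boxes_def in_keys_iff)
qed auto

lemma lookup_tab_wt:
  "Poly_Mapping.lookup (tab_wt \<alpha> T) i = card {b \<in> boxes \<alpha>. T b = i}"
proof -
  have "{i. card {b \<in> boxes \<alpha>. T b = i} \<noteq> 0} \<subseteq> T ` boxes \<alpha>"
    by (auto simp: finite_boxes)
  then have "finite {i. card {b \<in> boxes \<alpha>. T b = i} \<noteq> 0}"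
    using finite_boxes finite_surj by blast
  then show ?thesis
    by (simp add: tab_wt_def lookup_Abs_poly_mapping)
qed

lemma finite_SSKT: "finite (SSKT \<alpha> \<phi>)"
proof (rule finite_subset)
  show "SSKT \<alpha> \<phi> \<subseteq> (\<Pi>\<^sub>E b\<in>boxes \<alpha>. {..\<phi> (fst b)})"
    by (auto simp: SSKT_def key_tableau_def tableaux_def flagged_def PiE_iff extensional_def)
qed (auto intro: finite_PiE finite_boxes)

lemma lookup_flag_comp:
  assumes "strict_mono_on {1..} \<phi>"
  shows "i \<ge> 1 \<Longrightarrow> Poly_Mapping.lookup (flag_comp \<alpha> \<phi>) (\<phi> i) = Poly_Mapping.lookup \<alpha> i"
    and "\<nexists>i. i \<ge> 1 \<and> \<phi> i = j \<Longrightarrow> Poly_Mapping.lookup (flag_comp \<alpha> \<phi>) j = 0"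
proof -
  let ?g = "\<lambda>j. if \<exists>i\<ge>1. \<phi> i = j then Poly_Mapping.lookup \<alpha> (THE i. i \<ge> 1 \<and> \<phi> i = j) else 0"
  have the: "(THE k. k \<ge> 1 \<and> \<phi> k = \<phi> i) = i" if "i \<ge> 1" for i
    using that strict_mono_on_imp_inj_on[OF assms] by (auto dest: inj_onD)
  have g: "?g (\<phi> i) = Poly_Mapping.lookup \<alpha> i" if "i \<ge> 1" for i
    using that the[OF that] by auto
  have "{j. ?g j \<noteq> 0} \<subseteq> \<phi> ` Poly_Mapping.keys \<alpha>"
  proof
    fix j assume "j \<in> {j. ?g j \<noteq> 0}"
    then have j: "?g j \<noteq> 0" by simp
    then obtain i where i: "i \<ge> 1" "\<phi> i = j" by (auto split: if_splits)
    with j g[of i] have "Poly_Mapping.lookup \<alpha> i \<noteq> 0" by metis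
    with i show "j \<in> \<phi> ` Poly_Mapping.keys \<alpha>" by (auto simp: in_keys_iff)
  qed
  then have fin: "finite {j. ?g j \<noteq> 0}"
    by (rule finite_subset) simp
  have eq: "Poly_Mapping.lookup (flag_comp \<alpha> \<phi>) = ?g"
    unfolding flag_comp_def by (rule lookup_Abs_poly_mapping[OF fin])
  show "Poly_Mapping.lookup (flag_comp \<alpha> \<phi>) (\<phi> i) = Poly_Mapping.lookup \<alpha> i" if "i \<ge> 1"
    using g[OF that] by (simp only: eq)
  show "Poly_Mapping.lookup (flag_comp \<alpha> \<phi>) j = 0" if "\<nexists>i. i \<ge> 1 \<and> \<phi> i = j"
    using that by (auto simp: eq)
qed

end

theory Submission
  imports Defs
begin

text \<open>
  Read a tableau as a sequence of columns, a column being a function from rows to entries with value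
  0 at a missing box. The key conditions relate neighbouring columns only, and the flag only concerns
  the first column, so the generating function is a sum of transfer products.

  If two adjacent rows have the same flag, then for either order of their lengths the entries that
  they have in each column can be arranged in exactly one admissible way, and the conditions involving
  other rows do not depend on the arrangement; so the generating function does not change when the
  two lengths are exchanged. If the upper row is at least as long, its first entry is always the
  larger one. This gives the recursion for flags that are not strictly increasing.

  For the strict case it remains to see that \<open>\<pi>\<^sub>m\<close> turns the flag \<open>id\<close> into \<open>id + e\<^sub>m\<close>. Writing \<open>g\<close> for the
  second generating function and \<open>f\<close> for the first, \<open>g = \<pi>\<^sub>m f\<close> holds as soon as \<open>g\<close> is symmetric in
  \<open>x\<^sub>m, x\<^sub>m\<^sub>+\<^sub>1\<close> and \<open>g - f\<close> is \<open>x\<^sub>m\<^sub>+\<^sub>1\<close> times a symmetric polynomial. Merging the values \<open>m\<close> and \<open>m + 1\<close>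
  leaves at most two states for every column, and each of the few \<open>2 \<times> 2\<close> transfer matrices that
  occur preserves the property ``the sum of both components is symmetric, the second component is
  \<open>x\<^sub>m\<^sub>+\<^sub>1\<close> times a symmetric polynomial''.
\<close>

section \<open>Simple transpositions acting on the positions of a composition\<close>

lemma inj_simple_transp [simp]: "inj (simple_transp i)"
  by (simp add: simple_transp_def)

lemma simple_transp_involutory [simp]: "simple_transp i (simple_transp i j) = j"
  by (simp add: simple_transp_def)

lemma lookup_act_simple_transp:
  "Poly_Mapping.lookup (comp_act \<alpha> (simple_transp i)) j = Poly_Mapping.lookup \<alpha> (simple_transp i j)"
  by (simp add: lookup_comp_act)

lemma comp_act_simple_transp_involutory [simp]:
  "comp_act (comp_act \<alpha> (simple_transp i)) (simple_transp i) = \<alpha>"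
  by (rule poly_mapping_eqI) (simp add: lookup_act_simple_transp)

lemma comp_act_compose:
  "inj u \<Longrightarrow> inj w \<Longrightarrow> comp_act (comp_act \<alpha> u) w = comp_act \<alpha> (u \<circ> w)"
  by (rule poly_mapping_eqI) (simp add: lookup_comp_act inj_compose)

lemma weak_composition_act_simple_transp [simp]:
  "i \<ge> 1 \<Longrightarrow> weak_composition (comp_act \<alpha> (simple_transp i)) \<longleftrightarrow> weak_composition \<alpha>"
  unfolding weak_composition_def lookup_act_simple_transp by (simp add: simple_transp_def transpose_def)

subsection \<open>Exchanging two adjacent variables\<close>

lemma swap_vars_0 [simp]: "swap_vars i 0 = 0"
  by (rule poly_mapping_eqI) (simp add: lookup_swap_vars)

lemma swap_vars_add: "swap_vars i (f + g) = swap_vars i f + swap_vars i g"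
  by (rule poly_mapping_eqI) (simp add: lookup_swap_vars lookup_add)

lemma swap_vars_diff: "swap_vars i (f - g) = swap_vars i f - swap_vars i g"
  by (rule poly_mapping_eqI) (simp add: lookup_swap_vars lookup_minus)

lemma swap_vars_sum: "swap_vars i (sum f A) = (\<Sum>x\<in>A. swap_vars i (f x))"
  by (rule poly_mapping_eqI) (simp add: lookup_swap_vars lookup_sum)

lemma swap_vars_single:
  "swap_vars i (Poly_Mapping.single \<beta> k) = Poly_Mapping.single (comp_act \<beta> (simple_transp i)) k"
proof (rule poly_mapping_eqI)
  fix \<gamma>
  have "\<beta> = comp_act \<gamma> (simple_transp i) \<longleftrightarrow> comp_act \<beta> (simple_transp i) = \<gamma>"
    by (metis comp_act_simple_transp_involutory)
  then show "Poly_Mapping.lookup (swap_vars i (Poly_Mapping.single \<beta> k)) \<gamma> =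
      Poly_Mapping.lookup (Poly_Mapping.single (comp_act \<beta> (simple_transp i)) k) \<gamma>"
    by (simp add: lookup_swap_vars lookup_single when_def)
qed

lemma comp_act_add:
  "comp_act (\<beta> + \<gamma>) (simple_transp i) = comp_act \<beta> (simple_transp i) + comp_act \<gamma> (simple_transp i)"
  by (rule poly_mapping_eqI) (simp add: lookup_act_simple_transp lookup_add)

lemma ipoly_eq_sum_single:
  fixes f :: ipoly
  shows "f = (\<Sum>\<beta>\<in>Poly_Mapping.keys f. Poly_Mapping.single \<beta> (Poly_Mapping.lookup f \<beta>))"
proof (rule poly_mapping_eqI)
  fix \<gamma>
  have "(\<Sum>\<beta>\<in>Poly_Mapping.keys f. Poly_Mapping.lookup f \<beta> when \<beta> = \<gamma>) = Poly_Mapping.lookup f \<gamma>"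
    by (simp add: when_def in_keys_iff)
  then show "Poly_Mapping.lookup f \<gamma> = Poly_Mapping.lookup
      (\<Sum>\<beta>\<in>Poly_Mapping.keys f. Poly_Mapping.single \<beta> (Poly_Mapping.lookup f \<beta>)) \<gamma>"
    by (simp add: lookup_sum lookup_single)
qed

text \<open>Both sides are bilinear, so the factors may be expanded into terms with a single
  exponent vector; multiplying those adds the vectors, and the transposition acts additively on
  vectors.\<close>

lemma swap_vars_mult: "swap_vars i (f * g) = swap_vars i f * swap_vars i g"
proof -
  let ?s = "\<lambda>\<beta> f. Poly_Mapping.single \<beta> (Poly_Mapping.lookup f \<beta>)"
  have "swap_vars i ((\<Sum>\<beta>\<in>Poly_Mapping.keys f. ?s \<beta> f) * (\<Sum>\<gamma>\<in>Poly_Mapping.keys g. ?s \<gamma> g)) =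
      swap_vars i (\<Sum>\<beta>\<in>Poly_Mapping.keys f. ?s \<beta> f) * swap_vars i (\<Sum>\<gamma>\<in>Poly_Mapping.keys g. ?s \<gamma> g)"
    by (simp add: swap_vars_sum sum_product mult_single swap_vars_single comp_act_add)
  then show ?thesis
    by (simp flip: ipoly_eq_sum_single)
qed

lemma swap_vars_1 [simp]: "swap_vars i 1 = 1"
proof -
  have "comp_act 0 (simple_transp i) = 0"
    by (rule poly_mapping_eqI) (simp add: lookup_act_simple_transp)
  then show ?thesis
    by (simp flip: single_one add: swap_vars_single)
qed

lemma swap_vars_prod: "swap_vars i (prod f A) = (\<Prod>x\<in>A. swap_vars i (f x))"
  by (induction A rule: infinite_finite_induct) (simp_all add: swap_vars_mult)

lemma swap_vars_var: "swap_vars i (var j) = var (simple_transp i j)"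
proof -
  have "comp_act (Poly_Mapping.single j 1) (simple_transp i) = Poly_Mapping.single (simple_transp i j) 1"
    by (rule poly_mapping_eqI)
      (auto simp: lookup_act_simple_transp lookup_single when_def)
  then show ?thesis
    by (simp add: var_def monomial_def swap_vars_single)
qed

lemma var_inject [simp]: "var i = var j \<longleftrightarrow> i = j"
proof -
  have "Poly_Mapping.lookup (var i) (Poly_Mapping.single j 1) = (if i = j then 1 else 0)"
    for i j :: nat
  proof -
    have "Poly_Mapping.single i (1::nat) = Poly_Mapping.single j 1 \<longleftrightarrow> i = j"
      by (metis lookup_single_eq lookup_single_not_eq zero_neq_one)
    then show ?thesis
      by (auto simp: var_def monomial_def lookup_single when_def)
  qed
  then show ?thesis
    by (metis zero_neq_one)
qed

text \<open>\<open>divided_diff\<close> is a definite description, so a solution of its equation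
  must be shown unique: \<open>var i - var (i + 1)\<close> is nonzero and polynomials have no zero
  divisors. The premise is this equation for \<open>var i * f\<close>, with the exchange already
  carried out on the factor \<open>var i\<close>.\<close>

lemma pi_op_eqI:
  assumes "(var i - var (i + 1)) * g = var i * f - var (i + 1) * swap_vars i f"
  shows "pi_op i f = g"
proof -
  have eq: "var i * f - swap_vars i (var i * f) = (var i - var (i + 1)) * g"
    using assms by (simp add: swap_vars_mult swap_vars_var simple_transp_def)
  have "var i - var (i + 1) \<noteq> 0"
    by simp
  then have "h = g" if "(var i - var (i + 1)) * h = (var i - var (i + 1)) * g" for h
    using that mult_left_cancel by blast
  then show ?thesis
    unfolding pi_op_def divided_diff_def eq by (intro the_equality) auto
qed

section \<open>The weight of a tableau as a product of variables\<close>

lemma monomial_add: "monomial (\<beta> + \<gamma>) = monomial \<beta> * monomial \<gamma>"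
  by (simp only: monomial_def mult_single mult_1)

lemma monomial_0 [simp]: "monomial 0 = 1"
  by (simp only: monomial_def single_one)

lemma monomial_sum: "monomial (sum f A) = (\<Prod>x\<in>A. monomial (f x))"
  by (induction A rule: infinite_finite_induct)
    (simp_all add: monomial_add)

lemma monomial_tab_wt: "monomial (tab_wt \<alpha> T) = (\<Prod>b\<in>boxes \<alpha>. var (T b))"
proof -
  have "tab_wt \<alpha> T = (\<Sum>b\<in>boxes \<alpha>. Poly_Mapping.single (T b) 1)"
  proof (rule poly_mapping_eqI)
    fix i
    have "card {b \<in> boxes \<alpha>. T b = i} = (\<Sum>b\<in>boxes \<alpha>. if T b = i then 1 else 0 :: nat)"
      by (simp add: finite_boxes flip: sum.inter_filter)
    then show "Poly_Mapping.lookup (tab_wt \<alpha> T) i =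
        Poly_Mapping.lookup (\<Sum>b\<in>boxes \<alpha>. Poly_Mapping.single (T b) 1) i"
      by (simp only: lookup_tab_wt lookup_sum lookup_single when_def)
  qed
  then show ?thesis
    by (simp add: monomial_sum var_def)
qed

subsection \<open>Columns\<close>

text \<open>One bound \<open>N\<close> serves for rows and entries alike, which makes the set finite
  and keeps it stable under permuting rows or values within \<open>{1..N}\<close>. Only nonzero
  entries have to be distinct, since 0 marks missing boxes.\<close>

definition columns :: "nat \<Rightarrow> (nat \<Rightarrow> nat) set" where
  "columns N = {c. (\<forall>r. c r \<noteq> 0 \<longrightarrow> r \<in> {1..N} \<and> c r \<le> N) \<and>
     (\<forall>r s. c r = c s \<longrightarrow> c r \<noteq> 0 \<longrightarrow> r = s)}"

text \<open>With 0 for a missing box, weak decrease in a row also says that a box of the right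
  column has a left neighbour, and \<open>c k < d i\<close> already contains the existence of the
  box that condition (c) demands.\<close>

definition fits :: "(nat \<Rightarrow> nat) \<Rightarrow> (nat \<Rightarrow> nat) \<Rightarrow> bool" where
  "fits c d \<longleftrightarrow> (\<forall>r. d r \<le> c r) \<and>
     (\<forall>i k. i < k \<longrightarrow> 0 < c k \<longrightarrow> c k < c i \<longrightarrow> c k < d i)"

definition col_wt :: "nat \<Rightarrow> (nat \<Rightarrow> nat) \<Rightarrow> ipoly" where
  "col_wt N c = (\<Prod>r=1..N. if c r = 0 then 1 else var (c r))"

text \<open>
  The generating function of the fillings with first column \<open>c\<close> and row lengths \<open>A\<close>; it is meaningful
  only if \<open>A\<close> is bounded by the number \<open>n\<close> of columns.
\<close>

primrec col_sum :: "nat \<Rightarrow> nat \<Rightarrow> (nat \<Rightarrow> nat) \<Rightarrow> (nat \<Rightarrow> nat) \<Rightarrow> ipoly" where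
  "col_sum N 0 A c = (if c = (\<lambda>_. 0) then 1 else 0)"
| "col_sum N (Suc n) A c = (if \<forall>r. c r \<noteq> 0 \<longleftrightarrow> A r \<noteq> 0
     then col_wt N c * (\<Sum>d\<in>columns N. if fits c d then col_sum N n (\<lambda>r. A r - 1) d else 0)
     else 0)"

text \<open>The sequence is infinite and indexed from 0: \<open>U j\<close> is column
  \<open>j + 1\<close> of the tableau, and row \<open>r\<close> is zero from index
  \<open>A r\<close> on. So the number of columns does not enter the description.\<close>

definition fillings :: "nat \<Rightarrow> (nat \<Rightarrow> nat) \<Rightarrow> (nat \<Rightarrow> nat) \<Rightarrow> (nat \<Rightarrow> nat \<Rightarrow> nat) set" where
  "fillings N A c = {U. U 0 = c \<and> (\<forall>j. U j \<in> columns N) \<and> (\<forall>j r. U j r \<noteq> 0 \<longleftrightarrow> j < A r) \<and>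
     (\<forall>j. fits (U j) (U (Suc j)))}"

lemma finite_columns [simp]: "finite (columns N)"
proof (rule finite_subset)
  show "columns N \<subseteq> {f. \<forall>x. (x \<in> {1..N} \<longrightarrow> f x \<in> {..N}) \<and> (x \<notin> {1..N} \<longrightarrow> f x = 0)}"
  proof
    fix c assume "c \<in> columns N"
    then have c: "c r \<noteq> 0 \<Longrightarrow> r \<in> {1..N} \<and> c r \<le> N" for r
      unfolding columns_def by blast
    have "c r \<le> N" for r using c[of r] by (cases "c r = 0") auto
    then show "c \<in> {f. \<forall>x. (x \<in> {1..N} \<longrightarrow> f x \<in> {..N}) \<and> (x \<notin> {1..N} \<longrightarrow> f x = 0)}"
      using c by blast
  qed
qed (rule finite_set_of_finite_funs; simp)

lemma columns_inj: "c \<in> columns N \<Longrightarrow> c r = c s \<Longrightarrow> c r \<noteq> 0 \<Longrightarrow> r = s"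
  unfolding columns_def by blast

text \<open>Dropping the first column shifts the sequence and shortens every nonempty row by one;
  truncated subtraction leaves the empty rows empty.\<close>

lemma fillings_step:
  assumes "c \<in> columns N" and supp: "\<forall>r. c r \<noteq> 0 \<longleftrightarrow> A r \<noteq> 0"
  shows "fillings N A c =
    (\<Union>d\<in>{d \<in> columns N. fits c d}. case_nat c ` fillings N (\<lambda>r. A r - 1) d)"
proof (intro equalityI subsetI)
  fix U assume U: "U \<in> fillings N A c"
  have "(\<lambda>j. U (Suc j)) \<in> fillings N (\<lambda>r. A r - 1) (U 1)"
    using U by (auto simp: fillings_def)
  moreover have "U = case_nat c (\<lambda>j. U (Suc j))"
    using U by (auto simp: fillings_def fun_eq_iff split: nat.splits)
  moreover have "U 1 \<in> columns N" "fits c (U 1)"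
    using U by (auto simp: fillings_def)
  ultimately show "U \<in> (\<Union>d\<in>{d \<in> columns N. fits c d}. case_nat c ` fillings N (\<lambda>r. A r - 1) d)"
    by blast
next
  fix U assume "U \<in> (\<Union>d\<in>{d \<in> columns N. fits c d}. case_nat c ` fillings N (\<lambda>r. A r - 1) d)"
  then obtain V where V: "V \<in> fillings N (\<lambda>r. A r - 1) (V 0)" "fits c (V 0)" "U = case_nat c V"
    by (auto simp: fillings_def)
  have "U j \<in> columns N" for j
    using V assms(1) by (cases j) (auto simp: fillings_def)
  moreover have "U j r \<noteq> 0 \<longleftrightarrow> j < A r" for j r
  proof (cases j)
    case 0
    then show ?thesis using supp V(3) by simp
  next
    case (Suc l)
    have "V l r \<noteq> 0 \<longleftrightarrow> l < A r - 1"
      using V(1) unfolding fillings_def by blast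
    then show ?thesis using Suc V(3) by auto
  qed
  moreover have "fits (U j) (U (Suc j))" for j
    using V by (cases j) (auto simp: fillings_def)
  ultimately show "U \<in> fillings N A c"
    using V(3) by (simp add: fillings_def)
qed

text \<open>Finiteness is carried through the induction because the sum over the disjoint union of
  \<open>fillings_step\<close> requires finite pieces. The bound on \<open>A\<close> makes all
  columns from index \<open>n\<close> on zero.\<close>

lemma sum_fillings:
  assumes "\<forall>r. A r \<le> n" "c \<in> columns N"
  shows "finite (fillings N A c) \<and>
    col_sum N n A c = (\<Sum>U\<in>fillings N A c. \<Prod>j<n. col_wt N (U j))"
  using assms
proof (induction n arbitrary: A c)
  case 0
  have "fillings N A c = (if c = (\<lambda>_. 0) then {\<lambda>_ _. 0} else {})"
  proof -
    have "(\<lambda>_. 0) \<in> columns N" by (simp add: columns_def)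
    with 0 show ?thesis
      by (auto simp: fillings_def fits_def fun_eq_iff)
  qed
  then show ?case by simp
next
  case (Suc n)
  show ?case
  proof (cases "\<forall>r. c r \<noteq> 0 \<longleftrightarrow> A r \<noteq> 0")
    case False
    have "fillings N A c = {}"
    proof (rule equals0I)
      fix U assume "U \<in> fillings N A c"
      then have "U 0 = c" "\<And>r. U 0 r \<noteq> 0 \<longleftrightarrow> 0 < A r" by (auto simp: fillings_def)
      with False show False by auto
    qed
    then show ?thesis
      unfolding col_sum.simps using False by (simp only: if_False sum.empty finite.emptyI simp_thms)
  next
    case True
    let ?B = "\<lambda>r. A r - 1"
    let ?D = "{d \<in> columns N. fits c d}"
    have IH: "finite (fillings N ?B d)"
      "col_sum N n ?B d = (\<Sum>U\<in>fillings N ?B d. \<Prod>j<n. col_wt N (U j))" if "d \<in> columns N" for d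
      using Suc.IH[of ?B d] Suc.prems that by (auto simp: le_diff_conv)
    note step = fillings_step[OF Suc.prems(2) True]
    have inj: "inj_on (case_nat c) X" for X :: "(nat \<Rightarrow> nat \<Rightarrow> nat) set"
      by (rule inj_onI) (metis old.nat.simps(5) ext)
    have fin: "finite (fillings N A c)"
      unfolding step using IH by auto
    have "(\<Sum>U\<in>fillings N A c. \<Prod>j<Suc n. col_wt N (U j)) =
        (\<Sum>d\<in>?D. \<Sum>U\<in>case_nat c ` fillings N ?B d. \<Prod>j<Suc n. col_wt N (U j))"
      unfolding step
    proof (rule sum.UNION_disjoint)
      show "\<forall>d\<in>?D. \<forall>e\<in>?D. d \<noteq> e \<longrightarrow>
          case_nat c ` fillings N ?B d \<inter> case_nat c ` fillings N ?B e = {}"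
      proof (intro ballI impI equals0I)
        fix d e U
        assume "d \<noteq> e" and U: "U \<in> case_nat c ` fillings N ?B d \<inter> case_nat c ` fillings N ?B e"
        have "U 1 = d" if "U \<in> case_nat c ` fillings N ?B d" for d
          using that by (auto simp: fillings_def)
        with U \<open>d \<noteq> e\<close> show False by blast
      qed
    qed (use IH in auto)
    also have "\<dots> = (\<Sum>d\<in>?D. col_wt N c * col_sum N n ?B d)"
    proof (rule sum.cong[OF refl])
      fix d assume d: "d \<in> ?D"
      have "(\<Sum>U\<in>case_nat c ` fillings N ?B d. \<Prod>j<Suc n. col_wt N (U j)) =
          (\<Sum>U\<in>fillings N ?B d. \<Prod>j<Suc n. col_wt N (case j of 0 \<Rightarrow> c | Suc j \<Rightarrow> U j))"
        by (rule sum.reindex[OF inj, unfolded comp_def])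
      also have "\<dots> = (\<Sum>U\<in>fillings N ?B d. col_wt N c * (\<Prod>j<n. col_wt N (U j)))"
        unfolding prod.lessThan_Suc_shift by simp
      finally show "(\<Sum>U\<in>case_nat c ` fillings N ?B d. \<Prod>j<Suc n. col_wt N (U j)) =
          col_wt N c * col_sum N n ?B d"
        using d IH(2) by (simp only: sum_distrib_left mem_Collect_eq)
    qed
    also have "\<dots> = col_wt N c * (\<Sum>d\<in>columns N. if fits c d then col_sum N n ?B d else 0)"
      unfolding sum_distrib_left[symmetric] by (simp only: sum.inter_filter finite_columns)
    finally show ?thesis
      unfolding col_sum.simps if_P[OF True] using fin by (simp only: simp_thms)
  qed
qed

text \<open>Empty positions of the \<open>n\<close> by \<open>N\<close> grid contribute 1, so the
  product may be restricted to the nonzero entries; these correspond to the boxes after shifting the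
  column index by one.\<close>

lemma prod_boxes:
  assumes "weak_composition \<alpha>" and n: "\<And>r. Poly_Mapping.lookup \<alpha> r \<le> n"
    and N: "Poly_Mapping.keys \<alpha> \<subseteq> {..N}"
    and U: "\<And>j r. U j r \<noteq> 0 \<longleftrightarrow> (r, Suc j) \<in> boxes \<alpha>"
    and T: "\<And>j r. (r, Suc j) \<in> boxes \<alpha> \<Longrightarrow> T (r, Suc j) = U j r"
  shows "(\<Prod>b\<in>boxes \<alpha>. var (T b)) = (\<Prod>j<n. col_wt N (U j))"
proof -
  have "(\<Prod>j<n. col_wt N (U j)) =
      (\<Prod>(j, r)\<in>{..<n} \<times> {1..N}. if U j r = 0 then 1 else var (U j r))"
    unfolding col_wt_def by (rule prod.cartesian_product)
  also have "\<dots> = (\<Prod>(j, r)\<in>{(j, r) \<in> {..<n} \<times> {1..N}. U j r \<noteq> 0}. var (U j r))"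
    by (rule prod.mono_neutral_cong_right) (auto split: if_splits)
  also have "\<dots> = (\<Prod>b\<in>boxes \<alpha>. var (T b))"
  proof (rule prod.reindex_bij_witness[where i = "\<lambda>(r, c). (c - 1, r)" and j = "\<lambda>(j, r). (r, Suc j)"])
    fix b assume b: "b \<in> boxes \<alpha>"
    obtain r c where rc: "b = (r, c)" by (cases b)
    have "r \<in> Poly_Mapping.keys \<alpha>"
      using b by (auto simp: rc boxes_def in_keys_iff)
    then have "r \<le> N" using N by auto
    moreover have "c - 1 < n" using n[of r] b by (auto simp: rc boxes_def)
    moreover have "U (c - 1) r \<noteq> 0" using U[of "c - 1" r] b by (simp add: rc boxes_def)
    ultimately show "(case b of (r, c) \<Rightarrow> (c - 1, r)) \<in> {(j, r) \<in> {..<n} \<times> {1..N}. U j r \<noteq> 0}"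
      using b by (auto simp: rc boxes_def)
    show "(case case b of (r, c) \<Rightarrow> (c - 1, r) of (j, r) \<Rightarrow> (r, Suc j)) = b"
      using b by (auto simp: rc boxes_def)
  qed (use U T in auto)
  finally show ?thesis ..
qed

text \<open>A tableau is cut into its columns. Rows decrease weakly, so the flag restricts the
  entries of the first column alone; rows without boxes have entry 0 there and meet any
  bound.\<close>

lemma flagged_key_poly_eq_col_sum:
  assumes wc: "weak_composition \<alpha>" and n: "\<And>r. Poly_Mapping.lookup \<alpha> r \<le> n"
    and N: "Poly_Mapping.keys \<alpha> \<subseteq> {..N}" and \<phi>: "\<And>r. r \<in> Poly_Mapping.keys \<alpha> \<Longrightarrow> \<phi> r \<le> N"
  shows "flagged_key_poly \<alpha> \<phi> =
    (\<Sum>c\<in>{c \<in> columns N. \<forall>r. c r \<le> \<phi> r}. col_sum N n (Poly_Mapping.lookup \<alpha>) c)"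
proof -
  let ?A = "Poly_Mapping.lookup \<alpha>"
  let ?C = "{c \<in> columns N. \<forall>r. c r \<le> \<phi> r}"
  let ?F = "\<Union>c\<in>?C. fillings N ?A c"
  have boxes_iff: "(r, Suc j) \<in> boxes \<alpha> \<longleftrightarrow> j < ?A r" for r j
    using wc by (cases "r = 0") (auto simp: boxes_def weak_composition_def)
  have boxes_SucE: "\<exists>j. c = Suc j" if "(r, c) \<in> boxes \<alpha>" for r c
    using that by (cases c) (auto simp: boxes_def)
  have "(\<Sum>c\<in>?C. col_sum N n ?A c) = (\<Sum>c\<in>?C. \<Sum>U\<in>fillings N ?A c. \<Prod>j<n. col_wt N (U j))"
    using sum_fillings n by (intro sum.cong) auto
  also have "\<dots> = (\<Sum>U\<in>?F. \<Prod>j<n. col_wt N (U j))"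
    by (rule sum.UNION_disjoint[symmetric]) (use sum_fillings n in \<open>auto simp: fillings_def\<close>)
  also have "\<dots> = (\<Sum>T\<in>SSKT \<alpha> \<phi>. monomial (tab_wt \<alpha> T))"
  proof (rule sum.reindex_bij_witness[where
        i = "\<lambda>T j r. if (r, Suc j) \<in> boxes \<alpha> then T (r, Suc j) else 0" and
        j = "\<lambda>U. \<lambda>b\<in>boxes \<alpha>. U (snd b - 1) (fst b)"])
    fix U assume "U \<in> ?F"
    then have U: "\<And>j. U j \<in> columns N" "\<And>j r. U j r \<noteq> 0 \<longleftrightarrow> j < ?A r"
        "\<And>j. fits (U j) (U (Suc j))" "\<And>r. U 0 r \<le> \<phi> r"
      by (auto simp: fillings_def)
    let ?T = "\<lambda>b\<in>boxes \<alpha>. U (snd b - 1) (fst b)"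
    have T: "?T (r, Suc j) = U j r" if "j < ?A r" for r j
      using that by (simp add: boxes_iff)
    have le: "U (Suc j) r \<le> U j r" for j r
      using U(3) by (simp add: fits_def)
    then have le0: "U j r \<le> U 0 r" for j r
      using lift_Suc_antimono_le[of "\<lambda>j. U j r" 0 j] by simp
    show "(\<lambda>j r. if (r, Suc j) \<in> boxes \<alpha> then ?T (r, Suc j) else 0) = U"
      using U(2) by (auto simp: boxes_iff fun_eq_iff)
    show "?T \<in> SSKT \<alpha> \<phi>"
      unfolding SSKT_def key_tableau_def flagged_def mem_Collect_eq
    proof (intro conjI allI impI)
      show "?T \<in> tableaux \<alpha>"
        unfolding tableaux_def
      proof (intro PiE_I)
        fix b assume b: "b \<in> boxes \<alpha>"
        obtain r j where "b = (r, Suc j)"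
          using b boxes_SucE by (cases b) auto
        with b show "?T b \<in> {1..}"
          using U(2)[of j r] by (auto simp: boxes_iff)
      qed auto
      fix i j assume ij: "(i, j) \<in> boxes \<alpha>"
      then obtain l where l: "j = Suc l" using boxes_SucE by blast
      have li: "l < ?A i" using ij by (simp add: l boxes_iff)
      show "?T (i, j) \<le> \<phi> i"
        using le0[of l i] U(4)[of i] li by (simp only: l T)
      show "?T (i, j + 1) \<le> ?T (i, j)" if "(i, j + 1) \<in> boxes \<alpha>"
        using that ij le[of l i] by (simp add: l)
      fix k assume kj: "(k, j) \<in> boxes \<alpha>"
      have lk: "l < ?A k" using kj by (simp add: l boxes_iff)
      show "?T (i, j) \<noteq> ?T (k, j)" if "i \<noteq> k"
        using columns_inj[OF U(1), of l i k] U(2)[of l i] li lk that by (simp only: l T) auto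
      assume "i < k" "?T (k, j) < ?T (i, j)"
      then have *: "U l k < U (Suc l) i"
        using U(3)[of l] U(2)[of l k] li lk by (simp only: l T) (simp add: fits_def)
      then show 1: "(i, j + 1) \<in> boxes \<alpha>"
        using U(2)[of "Suc l" i] by (simp add: l boxes_iff)
      show "?T (k, j) < ?T (i, j + 1)"
        using * 1 kj by (simp add: l)
    qed
    show "monomial (tab_wt \<alpha> ?T) = (\<Prod>j<n. col_wt N (U j))"
      unfolding monomial_tab_wt
      by (rule prod_boxes[OF wc n N]) (use U(2) in \<open>auto simp: boxes_iff\<close>)
  next
    fix T assume "T \<in> SSKT \<alpha> \<phi>"
    then have key: "key_tableau \<alpha> T" and fl: "flagged \<alpha> \<phi> T" by (auto simp: SSKT_def)
    let ?U = "\<lambda>j r. if (r, Suc j) \<in> boxes \<alpha> then T (r, Suc j) else 0"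
    have Tab: "T \<in> tableaux \<alpha>" using key by (simp add: key_tableau_def)
    have pos: "T b \<noteq> 0" if "b \<in> boxes \<alpha>" for b
      using Tab that by (force simp: tableaux_def PiE_iff)
    show "(\<lambda>b\<in>boxes \<alpha>. ?U (snd b - 1) (fst b)) = T"
    proof
      fix b show "(\<lambda>b\<in>boxes \<alpha>. ?U (snd b - 1) (fst b)) b = T b"
        using Tab boxes_SucE[of "fst b" "snd b"]
        by (cases b; cases "b \<in> boxes \<alpha>") (auto simp: tableaux_def PiE_iff extensional_def)
    qed
    have U0: "?U j r \<le> \<phi> r" for j r
      using fl by (auto simp: flagged_def)
    have "?U j \<in> columns N" for j
      unfolding columns_def mem_Collect_eq
    proof (intro conjI allI impI)
      fix r assume "?U j r \<noteq> 0"
      then have b: "(r, Suc j) \<in> boxes \<alpha>" by (auto split: if_splits)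
      then have r: "r \<in> Poly_Mapping.keys \<alpha>" "r \<ge> 1" by (auto simp: boxes_def in_keys_iff)
      then show "r \<in> {1..N}" using N by auto
      show "?U j r \<le> N" using order_trans[OF U0[of r j] \<phi>[OF r(1)]] .
    next
      fix r s assume eq: "?U j r = ?U j s" and nz: "?U j r \<noteq> 0"
      have "(r, Suc j) \<in> boxes \<alpha>" using nz by (rule contrapos_np) simp
      moreover have "(s, Suc j) \<in> boxes \<alpha>" using nz unfolding eq by (rule contrapos_np) simp
      moreover have "T (r, Suc j) = T (s, Suc j)" using eq calculation by simp
      ultimately show "r = s"
        using key unfolding key_tableau_def by blast
    qed
    moreover have "?U j r \<noteq> 0 \<longleftrightarrow> j < ?A r" for j r
      using pos by (auto simp: boxes_iff)
    moreover have "fits (?U j) (?U (Suc j))" for j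
      unfolding fits_def
    proof (intro conjI allI impI)
      fix r
      have "(r, Suc j) \<in> boxes \<alpha>" if "(r, Suc (Suc j)) \<in> boxes \<alpha>"
        using that by (simp add: boxes_def)
      moreover have "T (r, Suc j + 1) \<le> T (r, Suc j)" if "(r, Suc j + 1) \<in> boxes \<alpha>" "(r, Suc j) \<in> boxes \<alpha>"
        using key that unfolding key_tableau_def by blast
      ultimately show "?U (Suc j) r \<le> ?U j r" by simp
    next
      fix i k assume ik: "i < k" and pk: "0 < ?U j k" and less: "?U j k < ?U j i"
      have k: "(k, Suc j) \<in> boxes \<alpha>" using pk by (rule contrapos_pp) simp
      have i: "(i, Suc j) \<in> boxes \<alpha>" using less by (rule contrapos_pp) simp
      have "T (k, Suc j) < T (i, Suc j)" using less i k by simp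
      then have "(i, Suc j + 1) \<in> boxes \<alpha> \<and> T (k, Suc j) < T (i, Suc j + 1)"
        using key ik i k unfolding key_tableau_def by blast
      then show "?U j k < ?U (Suc j) i" using k by simp
    qed
    ultimately have "?U \<in> fillings N ?A (?U 0)"
      unfolding fillings_def by blast
    then show "?U \<in> ?F"
      using U0 \<open>\<And>j. ?U j \<in> columns N\<close> by blast
  qed
  finally show ?thesis
    by (simp add: flagged_key_poly_def)
qed

subsection \<open>Exchanging two adjacent rows\<close>

text \<open>\<open>S\<close> selects every fixed point of \<open>t\<close> and one element of each
  two-element orbit; the summand 0 keeps a fixed point from being counted twice.\<close>

lemma sum_involution:
  fixes f :: "'a \<Rightarrow> 'b::comm_monoid_add"
  assumes "finite C" "\<And>c. c \<in> C \<Longrightarrow> t c \<in> C" "\<And>c. c \<in> C \<Longrightarrow> t (t c) = c"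
    and "\<And>c. c \<in> C \<Longrightarrow> t c = c \<Longrightarrow> S c" "\<And>c. c \<in> C \<Longrightarrow> t c \<noteq> c \<Longrightarrow> S (t c) \<longleftrightarrow> \<not> S c"
  shows "sum f C = (\<Sum>c\<in>{c \<in> C. S c}. f c + (if t c = c then 0 else f (t c)))"
proof -
  have "sum f C = sum f ({c \<in> C. S c} \<union> {c \<in> C. \<not> S c})"
    by (rule arg_cong2[where f = sum]) auto
  also have "\<dots> = sum f {c \<in> C. S c} + sum f {c \<in> C. \<not> S c}"
    by (rule sum.union_disjoint) (use assms(1) in auto)
  also have "sum f {c \<in> C. \<not> S c} = (\<Sum>c\<in>{c \<in> C. S c \<and> t c \<noteq> c}. f (t c))"
  proof -
    have "t c \<noteq> c" if "c \<in> C" "\<not> S c" for c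
      using assms(4) that by metis
    then show ?thesis
      by (intro sum.reindex_bij_witness[of _ t t]) (use assms in auto)
  qed
  also have "\<dots> = (\<Sum>c\<in>{c \<in> C. S c}. if t c = c then 0 else f (t c))"
    by (rule sum.mono_neutral_cong_left) (use assms(1) in auto)
  finally show ?thesis
    by (simp add: sum.distrib)
qed

lemma swap_rows_involutory [simp]: "(c \<circ> simple_transp p) \<circ> simple_transp p = c"
  by (simp add: fun_eq_iff)

lemma simple_transp_apply:
  "simple_transp p p = Suc p" "simple_transp p (Suc p) = p"
  "r \<noteq> p \<Longrightarrow> r \<noteq> Suc p \<Longrightarrow> simple_transp p r = r"
  by (simp_all add: simple_transp_def)

lemma swap_rows_eq_iff: "c \<circ> simple_transp p = c \<longleftrightarrow> c p = c (Suc p)"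
proof
  assume "c p = c (Suc p)"
  then have "c (simple_transp p r) = c r" for r
    by (cases "r = p \<or> r = Suc p") (auto simp: simple_transp_apply)
  then show "c \<circ> simple_transp p = c" by (simp add: fun_eq_iff)
qed (metis comp_apply simple_transp_apply(1))

lemma simple_transp_less:
  assumes "i < k" "\<not> (i = p \<and> k = Suc p)"
  shows "simple_transp p i < simple_transp p k"
  using assms by (auto simp: simple_transp_def transpose_def)

lemma simple_transp_permutes: "1 \<le> p \<Longrightarrow> Suc p \<le> N \<Longrightarrow> simple_transp p permutes {1..N}"
  unfolding simple_transp_def by (rule permutes_swap_id) auto

lemma columns_swap_rows:
  assumes "1 \<le> p" "Suc p \<le> N" "c \<in> columns N"
  shows "c \<circ> simple_transp p \<in> columns N"
proof -
  have "r \<in> {1..N}" if "simple_transp p r \<in> {1..N}" for r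
    using that permutes_in_image[OF simple_transp_permutes[OF assms(1,2)]] by metis
  moreover have "r = s" if "simple_transp p r = simple_transp p s" for r s
    using that by (metis simple_transp_involutory)
  ultimately show ?thesis
    using assms(3) unfolding columns_def mem_Collect_eq comp_apply by metis
qed

lemma col_wt_swap_rows:
  assumes "1 \<le> p" "Suc p \<le> N"
  shows "col_wt N (c \<circ> simple_transp p) = col_wt N c"
  unfolding col_wt_def
  using prod.permute[OF simple_transp_permutes[OF assms], of "\<lambda>r. if c r = 0 then 1 else var (c r)"]
  by (simp only: comp_def)

text \<open>Rows \<open>p\<close> and \<open>Suc p\<close> are the only pair whose order
  \<open>simple_transp p\<close> reverses, so condition (c) needs new input for this pair alone; the
  second premise is that input.\<close>

lemma fits_swap_rows_imp:
  assumes "fits c d" "0 < c p \<Longrightarrow> c p < c (Suc p) \<Longrightarrow> c p < d (Suc p)"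
  shows "fits (c \<circ> simple_transp p) (d \<circ> simple_transp p)"
  unfolding fits_def comp_apply
proof (intro conjI allI impI)
  fix i k
  assume ik: "i < k" "0 < c (simple_transp p k)" "c (simple_transp p k) < c (simple_transp p i)"
  show "c (simple_transp p k) < d (simple_transp p i)"
  proof (cases "i = p \<and> k = Suc p")
    case True
    then show ?thesis using assms(2) ik by (simp add: simple_transp_apply)
  next
    case False
    from simple_transp_less[OF ik(1) False] show ?thesis
      using assms(1) ik by (simp add: fits_def)
  qed
qed (use assms(1) in \<open>simp add: fits_def\<close>)

text \<open>After the exchange the larger entry is in row \<open>p\<close>, and the second premise
  is what (c) then asks of rows \<open>p\<close> and \<open>Suc p\<close>; before the exchange (c)
  says nothing about this pair.\<close>

lemma fits_swap_rows:
  assumes "c p < c (Suc p)" "0 < c p \<Longrightarrow> c p < d (Suc p)"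
  shows "fits (c \<circ> simple_transp p) (d \<circ> simple_transp p) \<longleftrightarrow> fits c d"
proof
  assume "fits (c \<circ> simple_transp p) (d \<circ> simple_transp p)"
  then show "fits c d"
    using fits_swap_rows_imp[of "c \<circ> simple_transp p" "d \<circ> simple_transp p" p] assms(1)
    by (simp add: simple_transp_apply)
qed (use assms fits_swap_rows_imp in auto)

text \<open>
  The intervals from \<open>d p\<close> to \<open>c p\<close> and from \<open>d (p + 1)\<close> to \<open>c (p + 1)\<close> overlap, so their union, which is
  what the rows above have to avoid, does not change when the left end points are exchanged.
\<close>

lemma fits_swap_right_imp:
  assumes "fits c d" "c p < c (Suc p)" "d p \<le> c p" "d (Suc p) \<le> c p"
  shows "fits c (d \<circ> simple_transp p)"
  unfolding fits_def comp_apply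
proof (intro conjI allI impI)
  fix r show "d (simple_transp p r) \<le> c r"
    using assms(2-4) assms(1)[unfolded fits_def, THEN conjunct1, THEN spec, of r]
    by (cases "r = p"; cases "r = Suc p") (simp_all add: simple_transp_apply)
next
  fix i k assume ik: "i < k" "0 < c k" "c k < c i"
  have *: "c k < d j" if "j < k" "c k < c j" for j
    using assms(1) ik(2) that by (simp add: fits_def)
  consider "i = p" | "i = Suc p" | "i \<noteq> p" "i \<noteq> Suc p" by blast
  then show "c k < d (simple_transp p i)"
  proof cases
    case 1
    then have "k > Suc p" using ik assms(2) by (metis Suc_lessI less_asym)
    then show ?thesis using *[of "Suc p"] ik assms(2) 1 by (simp add: simple_transp_apply)
  next
    case 2
    then have "c k < d (Suc p)" using * ik by simp
    then have "c k < c p" using assms(4) by simp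
    then show ?thesis using *[of p] ik 2 by (simp add: simple_transp_apply)
  next
    case 3
    then show ?thesis using * ik by (simp add: simple_transp_apply)
  qed
qed

lemma fits_swap_right:
  assumes "c p < c (Suc p)" "d p \<le> c p" "d (Suc p) \<le> c p"
  shows "fits c (d \<circ> simple_transp p) \<longleftrightarrow> fits c d"
  using assms fits_swap_right_imp[of c "d \<circ> simple_transp p" p] fits_swap_right_imp[of c d p]
  by (auto simp: simple_transp_apply)

text \<open>An inversion \<open>c (Suc p) < c p\<close> would by (c) force
  \<open>c (Suc p) < d p\<close> in the next column \<open>d\<close>. That column is sorted by
  induction, so \<open>d p \<le> d (Suc p) \<le> c (Suc p)\<close>, a contradiction.\<close>

lemma col_sum_nonzero_imp_sorted:
  assumes "A p \<le> A (Suc p)" "c \<in> columns N" "col_sum N n A c \<noteq> 0"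
  shows "c p \<le> c (Suc p)"
  using assms
proof (induction n arbitrary: A c)
  case 0
  then show ?case by (auto split: if_splits)
next
  case (Suc n)
  let ?B = "\<lambda>r. A r - 1"
  have supp: "\<forall>r. c r \<noteq> 0 \<longleftrightarrow> A r \<noteq> 0"
    and nz: "(\<Sum>d\<in>columns N. if fits c d then col_sum N n ?B d else 0) \<noteq> 0"
    using Suc.prems(3) by (auto split: if_splits)
  obtain d where "d \<in> columns N" "(if fits c d then col_sum N n ?B d else 0) \<noteq> 0"
    using sum.not_neutral_contains_not_neutral[OF nz] by blast
  then have d: "d \<in> columns N" "fits c d" "col_sum N n ?B d \<noteq> 0"
    by (auto split: if_splits)
  have "d p \<le> d (Suc p)"
    using Suc.IH[of ?B d] Suc.prems(1) d by simp
  show ?case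
  proof (rule ccontr)
    assume "\<not> c p \<le> c (Suc p)"
    then have less: "c (Suc p) < c p" by simp
    \<comment> \<open>If this entry were 0, row \<open>Suc p\<close> would be empty and hence row
      \<open>p\<close> as well, against the inversion.\<close>
    then have "0 < c (Suc p)"
      using supp Suc.prems(1) by (metis gr0I le_zero_eq less_zeroE)
    then have "c (Suc p) < d p"
      using d(2) less by (simp add: fits_def)
    also have "\<dots> \<le> d (Suc p)" by fact
    also have "\<dots> \<le> c (Suc p)" using d(2) by (simp add: fits_def)
    finally show False by simp
  qed
qed

text \<open>
  When the longer row is on top, only sorted columns contribute; each of them collects the
  contributions of both arrangements in the other shape.
\<close>

lemma col_sum_swap_rows:
  assumes p: "1 \<le> p" "Suc p \<le> N"
    and "A (Suc p) \<le> A p" "c \<in> columns N" "c p \<le> c (Suc p)"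
  shows "col_sum N n (A \<circ> simple_transp p) c = col_sum N n A c +
    (if c \<circ> simple_transp p = c then 0 else col_sum N n A (c \<circ> simple_transp p))"
  using assms(3-5)
proof (induction n arbitrary: A c)
  case 0
  show ?case
  proof (cases "c = (\<lambda>_. 0)")
    case False
    then have "c \<circ> simple_transp p \<noteq> (\<lambda>_. 0)"
      by (metis comp_apply ext simple_transp_involutory)
    then show ?thesis using False by simp
  qed (auto simp: comp_def)
next
  case (Suc n)
  let ?s = "simple_transp p"
  define B where "B = (\<lambda>r. A r - 1)"
  define X where "X = col_sum N n B"
  define Y where "Y = col_sum N n (B \<circ> ?s)"
  define G where "G e f = (\<Sum>d\<in>columns N. if fits e d then f d else 0)"
    for e and f :: "(nat \<Rightarrow> nat) \<Rightarrow> ipoly"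
  let ?D = "{d \<in> columns N. d p \<le> d (Suc p)}"
  have Bs: "(\<lambda>r. (A \<circ> ?s) r - 1) = B \<circ> ?s" by (auto simp: B_def)
  have B_le: "B (Suc p) \<le> B p" using Suc.prems(1) by (simp add: B_def)
  have colA: "col_sum N (Suc n) A e =
      (if \<forall>r. e r \<noteq> 0 \<longleftrightarrow> A r \<noteq> 0 then col_wt N e * G e X else 0)" for e
    by (simp only: col_sum.simps G_def X_def B_def)
  have colAs: "col_sum N (Suc n) (A \<circ> ?s) e =
      (if \<forall>r. e r \<noteq> 0 \<longleftrightarrow> (A \<circ> ?s) r \<noteq> 0 then col_wt N e * G e Y else 0)" for e
    by (simp only: col_sum.simps G_def Y_def Bs)
  have Y: "Y d = X d + (if d \<circ> ?s = d then 0 else X (d \<circ> ?s))" if "d \<in> ?D" for d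
    unfolding X_def Y_def by (rule Suc.IH[OF B_le]) (use that in auto)
  \<comment> \<open>In the exchanged shape row \<open>Suc p\<close> is at least as long as row
    \<open>p\<close>, so unsorted columns drop out; in the original shape both arrangements of a
    sorted column are kept.\<close>
  have Y0: "Y d = 0" if "d \<in> columns N" "d \<notin> ?D" for d
    using col_sum_nonzero_imp_sorted[of "B \<circ> ?s" p d N n] B_le that
    by (auto simp: Y_def simple_transp_apply)
  have GX: "G e X = (\<Sum>d\<in>?D. (if fits e d then X d else 0) +
      (if d \<circ> ?s = d then 0 else if fits e (d \<circ> ?s) then X (d \<circ> ?s) else 0))" for e
    unfolding G_def
    by (rule sum_involution)
      (use columns_swap_rows p in \<open>auto simp: swap_rows_eq_iff simple_transp_apply\<close>)
  have GY: "G e Y = (\<Sum>d\<in>?D. if fits e d then Y d else 0)" for e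
    unfolding G_def by (rule sum.mono_neutral_right) (use Y0 in auto)
  have wt: "col_wt N (c \<circ> ?s) = col_wt N c"
    by (rule col_wt_swap_rows[OF p])
  have supp_swap: "(\<forall>r. (c \<circ> ?s) r \<noteq> 0 \<longleftrightarrow> A r \<noteq> 0) \<longleftrightarrow> (\<forall>r. c r \<noteq> 0 \<longleftrightarrow> (A \<circ> ?s) r \<noteq> 0)"
    by (metis comp_apply simple_transp_involutory)
  \<comment> \<open>Equal entries must be 0 by distinctness, so the cases are: both rows empty in
    this column, only row \<open>Suc p\<close> occupied, both occupied.\<close>
  consider "c p = c (Suc p)" | "c p = 0" "0 < c (Suc p)" | "0 < c p" "c p < c (Suc p)"
    using Suc.prems(3) by linarith
  then show ?case
  proof cases
    case 1
    then have cs: "c \<circ> ?s = c" by (simp add: swap_rows_eq_iff)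
    have c0: "c p = 0" "c (Suc p) = 0"
      using 1 columns_inj[OF Suc.prems(2), of p "Suc p"] by auto
    show ?thesis
    proof (cases "A p = 0")
      case True
      then have "A \<circ> ?s = A" using Suc.prems(1) by (simp add: swap_rows_eq_iff)
      then show ?thesis by (simp only: cs) simp
    next
      case False
      then have nA: "\<not> (\<forall>r. c r \<noteq> 0 \<longleftrightarrow> A r \<noteq> 0)" using c0 by metis
      then have nAs: "\<not> (\<forall>r. c r \<noteq> 0 \<longleftrightarrow> (A \<circ> ?s) r \<noteq> 0)"
        unfolding supp_swap[symmetric] cs .
      show ?thesis
        unfolding cs colA colAs if_not_P[OF nA] if_not_P[OF nAs] by simp
    qed
  next
    case 2
    then have ne: "c \<circ> ?s \<noteq> c" by (simp add: swap_rows_eq_iff)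
    have nA: "\<not> (\<forall>r. c r \<noteq> 0 \<longleftrightarrow> A r \<noteq> 0)"
    proof
      assume "\<forall>r. c r \<noteq> 0 \<longleftrightarrow> A r \<noteq> 0"
      then have "A (Suc p) \<noteq> 0" "A p = 0" using 2 by (metis less_irrefl)+
      then show False using Suc.prems(1) by simp
    qed
    have 0: "col_sum N (Suc n) A c = 0"
      unfolding colA if_not_P[OF nA] ..
    have G: "G c Y = G (c \<circ> ?s) X" if supp: "\<forall>r. (c \<circ> ?s) r \<noteq> 0 \<longleftrightarrow> A r \<noteq> 0"
      unfolding GX GY
    proof (rule sum.cong[OF refl])
      fix d assume d: "d \<in> ?D"
      have A0: "A (Suc p) = 0"
        using supp 2(1) by (metis comp_apply simple_transp_apply(2))
      \<comment> \<open>Row \<open>Suc p\<close> is empty in the original shape, so a column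
        occupying it contributes nothing.\<close>
      have Xd: "X d = 0" if "d p = 0" "d (Suc p) \<noteq> 0"
      proof (cases n)
        case 0
        then show ?thesis using that by (auto simp: X_def)
      next
        case (Suc m)
        have "B (Suc p) = 0" using A0 by (simp add: B_def)
        then show ?thesis using that unfolding X_def Suc col_sum.simps by metis
      qed
      have le: "d p \<le> c p" "d (Suc p) \<le> c (Suc p)" if "fits c d"
        using that by (auto simp: fits_def)
      have le': "e (Suc p) = 0" if "fits (c \<circ> ?s) e" for e
        using that 2 unfolding fits_def by (metis comp_apply le_zero_eq simple_transp_apply(2))
      have swap: "fits (c \<circ> ?s) (d \<circ> ?s) \<longleftrightarrow> fits c d"
        by (rule fits_swap_rows) (use 2 in auto)
      show "(if fits c d then Y d else 0) = (if fits (c \<circ> ?s) d then X d else 0) +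
          (if d \<circ> ?s = d then 0 else if fits (c \<circ> ?s) (d \<circ> ?s) then X (d \<circ> ?s) else 0)"
      proof (cases "d \<circ> ?s = d")
        case True
        then show ?thesis using swap Y[OF d] by simp
      next
        case False
        then have "d (Suc p) \<noteq> 0" using d by (auto simp: swap_rows_eq_iff)
        then have "\<not> fits (c \<circ> ?s) d" using le'[of d] by argo
        moreover have "X d = 0" if "fits c d"
          using Xd le[OF that] 2 \<open>d (Suc p) \<noteq> 0\<close> by simp
        ultimately show ?thesis using swap Y[OF d] False by auto
      qed
    qed
    show ?thesis
      unfolding 0 colA[of "c \<circ> ?s"] colAs wt supp_swap if_not_P[OF ne] add_0
      by (rule if_cong[OF refl _ refl], rule arg_cong[of _ _ "(*) _"], rule G[unfolded supp_swap])
  next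
    case 3
    then have ne: "c \<circ> ?s \<noteq> c" by (simp add: swap_rows_eq_iff)
    have supp_eq: "(\<forall>r. (c \<circ> ?s) r \<noteq> 0 \<longleftrightarrow> A r \<noteq> 0) \<longleftrightarrow> (\<forall>r. c r \<noteq> 0 \<longleftrightarrow> A r \<noteq> 0)"
    proof -
      have "(c \<circ> ?s) r \<noteq> 0 \<longleftrightarrow> c r \<noteq> 0" for r
        using 3 by (cases "r = p \<or> r = Suc p") (auto simp: simple_transp_apply)
      then show ?thesis by metis
    qed
    have G: "G c Y = G c X + G (c \<circ> ?s) X"
      unfolding GX GY sum.distrib[symmetric]
    proof (rule sum.cong[OF refl])
      fix d assume d: "d \<in> ?D"
      \<comment> \<open>The exchanged column is inverted in rows \<open>p\<close> and
        \<open>Suc p\<close>; by (c) and row decrease its successor is then inverted too, which a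
        sorted \<open>d\<close> is not.\<close>
      have no: "\<not> fits (c \<circ> ?s) d"
      proof
        assume f: "fits (c \<circ> ?s) d"
        then have "c p < d p"
          using 3 unfolding fits_def
          by (metis comp_apply lessI simple_transp_apply(1,2))
        moreover have "d (Suc p) \<le> c p"
          using f unfolding fits_def by (metis comp_apply simple_transp_apply(2))
        ultimately show False using d by simp
      qed
      show "(if fits c d then Y d else 0) = (if fits c d then X d else 0) +
          (if d \<circ> ?s = d then 0 else if fits c (d \<circ> ?s) then X (d \<circ> ?s) else 0) +
          ((if fits (c \<circ> ?s) d then X d else 0) +
          (if d \<circ> ?s = d then 0 else if fits (c \<circ> ?s) (d \<circ> ?s) then X (d \<circ> ?s) else 0))"
      \<comment> \<open>\<open>Y d\<close> stands for both arrangements of \<open>d\<close>. If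
        \<open>d (Suc p) \<le> c p\<close>, both or neither can follow \<open>c\<close>, and none
        follows the exchanged \<open>c\<close>. Otherwise only \<open>d\<close> can follow
        \<open>c\<close>, and only its exchange can follow the exchanged \<open>c\<close>.\<close>
      proof (cases "d (Suc p) \<le> c p")
        case True
        have "fits c (d \<circ> ?s) \<longleftrightarrow> fits c d"
          by (rule fits_swap_right) (use True 3 d in auto)
        moreover have "\<not> fits (c \<circ> ?s) (d \<circ> ?s)"
        proof
          assume "fits (c \<circ> ?s) (d \<circ> ?s)"
          then have "c p < d (Suc p)"
            using 3 unfolding fits_def
            by (metis comp_apply lessI simple_transp_apply(1,2))
          with True show False by simp
        qed
        ultimately show ?thesis using no Y[OF d] by simp
      next
        case False
        have "fits (c \<circ> ?s) (d \<circ> ?s) \<longleftrightarrow> fits c d"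
          by (rule fits_swap_rows) (use False 3 in auto)
        moreover have "\<not> fits c (d \<circ> ?s)"
          using False unfolding fits_def by (metis comp_apply simple_transp_apply(1))
        ultimately show ?thesis using no Y[OF d] by simp
      qed
    qed
    show ?thesis
      unfolding colA colAs wt supp_swap[symmetric] supp_eq if_not_P[OF ne]
    proof (cases "\<forall>r. c r \<noteq> 0 \<longleftrightarrow> A r \<noteq> 0")
      case True
      show "(if \<forall>r. c r \<noteq> 0 \<longleftrightarrow> A r \<noteq> 0 then col_wt N c * G c Y else 0) =
          (if \<forall>r. c r \<noteq> 0 \<longleftrightarrow> A r \<noteq> 0 then col_wt N c * G c X else 0) +
          (if \<forall>r. c r \<noteq> 0 \<longleftrightarrow> A r \<noteq> 0 then col_wt N c * G (c \<circ> ?s) X else 0)"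
        unfolding if_P[OF True] G by (rule distrib_left)
    next
      case False
      show "(if \<forall>r. c r \<noteq> 0 \<longleftrightarrow> A r \<noteq> 0 then col_wt N c * G c Y else 0) =
          (if \<forall>r. c r \<noteq> 0 \<longleftrightarrow> A r \<noteq> 0 then col_wt N c * G c X else 0) +
          (if \<forall>r. c r \<noteq> 0 \<longleftrightarrow> A r \<noteq> 0 then col_wt N c * G (c \<circ> ?s) X else 0)"
        unfolding if_not_P[OF False] by simp
    qed
  qed
qed

lemma bounded_comp:
  obtains n where "\<And>r. Poly_Mapping.lookup (\<alpha> :: comp) r \<le> n"
proof
  fix r
  show "Poly_Mapping.lookup \<alpha> r \<le> (\<Sum>r\<in>Poly_Mapping.keys \<alpha>. Poly_Mapping.lookup \<alpha> r)"
    by (cases "r \<in> Poly_Mapping.keys \<alpha>") (auto simp: in_keys_iff intro: member_le_sum)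
qed

text \<open>Equal flags make the admissible first columns stable under exchanging the two rows.
  Folding the sum onto sorted columns turns it by \<open>col_sum_swap_rows\<close> into a sum for
  the other shape, in which unsorted columns contribute 0.\<close>

lemma flagged_key_poly_swap_rows:
  assumes wc: "weak_composition \<alpha>" and i: "1 \<le> i" and eq: "\<phi> i = \<phi> (i + 1)"
    and le: "Poly_Mapping.lookup \<alpha> (i + 1) \<le> Poly_Mapping.lookup \<alpha> i"
  shows "flagged_key_poly \<alpha> \<phi> = flagged_key_poly (comp_act \<alpha> (simple_transp i)) \<phi>"
proof -
  let ?s = "simple_transp i"
  let ?\<beta> = "comp_act \<alpha> ?s"
  let ?K = "Poly_Mapping.keys \<alpha> \<union> Poly_Mapping.keys ?\<beta>"
  obtain n where n: "\<And>r. Poly_Mapping.lookup \<alpha> r \<le> n" using bounded_comp by blast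
  \<comment> \<open>\<open>N\<close> bounds the rows and flags of both shapes and reaches
    \<open>Suc i\<close>, so that the exchange of rows stays inside
    \<open>columns N\<close>.\<close>
  define N where "N = Max (insert (Suc i) (?K \<union> \<phi> ` ?K))"
  have N: "x \<le> N" if "x \<in> insert (Suc i) (?K \<union> \<phi> ` ?K)" for x
    unfolding N_def by (rule Max_ge) (use that in auto)
  let ?C = "{c \<in> columns N. \<forall>r. c r \<le> \<phi> r}"
  let ?A = "Poly_Mapping.lookup \<alpha>"
  have A\<beta>: "Poly_Mapping.lookup ?\<beta> = ?A \<circ> ?s"
    by (auto simp: lookup_act_simple_transp)
  have inv: "c \<circ> ?s \<in> ?C" if "c \<in> ?C" for c
  proof -
    have "(c \<circ> ?s) r \<le> \<phi> r" for r
    proof -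
      have "c (?s r) \<le> \<phi> (?s r)" using that by simp
      also have "\<phi> (?s r) = \<phi> r"
        using eq by (cases "r = i \<or> r = Suc i") (auto simp: simple_transp_apply)
      finally show ?thesis by simp
    qed
    then show ?thesis using columns_swap_rows[OF i N] that by simp
  qed
  have "flagged_key_poly \<alpha> \<phi> = (\<Sum>c\<in>?C. col_sum N n ?A c)"
    by (rule flagged_key_poly_eq_col_sum[OF wc n]) (use N in auto)
  also have "\<dots> = (\<Sum>c\<in>{c \<in> ?C. c i \<le> c (Suc i)}. col_sum N n ?A c +
      (if c \<circ> ?s = c then 0 else col_sum N n ?A (c \<circ> ?s)))"
  proof (rule sum_involution)
    show "c \<circ> ?s \<in> ?C" if "c \<in> ?C" for c
      using inv that .
  qed (auto simp: swap_rows_eq_iff simple_transp_apply)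
  also have "\<dots> = (\<Sum>c\<in>{c \<in> ?C. c i \<le> c (Suc i)}. col_sum N n (?A \<circ> ?s) c)"
    by (rule sum.cong[OF refl], rule col_sum_swap_rows[symmetric]) (use i le N in auto)
  also have "\<dots> = (\<Sum>c\<in>?C. col_sum N n (?A \<circ> ?s) c)"
    by (rule sum.mono_neutral_left)
      (use col_sum_nonzero_imp_sorted[of "?A \<circ> ?s" i] le in \<open>auto simp: simple_transp_apply\<close>)
  also have "\<dots> = flagged_key_poly ?\<beta> \<phi>"
    unfolding A\<beta>[symmetric]
    by (rule flagged_key_poly_eq_col_sum[symmetric])
      (use wc i n N in \<open>auto simp: lookup_act_simple_transp\<close>)
  finally show ?thesis .
qed

text \<open>A first column that is lost has the entry \<open>\<phi> i\<close> in row
  \<open>i\<close>. If it contributes, it is sorted by \<open>col_sum_nonzero_imp_sorted\<close>, so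
  row \<open>Suc i\<close> has this entry too, against distinctness.\<close>

lemma flagged_key_poly_decrease_flag:
  assumes wc: "weak_composition \<alpha>" and i: "1 \<le> i" and eq: "\<phi> i = \<phi> (i + 1)"
    and le: "Poly_Mapping.lookup \<alpha> i \<le> Poly_Mapping.lookup \<alpha> (i + 1)"
  shows "flagged_key_poly \<alpha> \<phi> = flagged_key_poly \<alpha> (flag_minus_e \<phi> i)"
proof -
  let ?K = "Poly_Mapping.keys \<alpha>"
  obtain n where n: "\<And>r. Poly_Mapping.lookup \<alpha> r \<le> n" using bounded_comp by blast
  define N where "N = Max (insert 0 (?K \<union> \<phi> ` ?K))"
  have N: "x \<le> N" if "x \<in> ?K \<union> \<phi> ` ?K" for x
    unfolding N_def by (rule Max_ge) (use that in auto)
  let ?A = "Poly_Mapping.lookup \<alpha>"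
  have N': "flag_minus_e \<phi> i r \<le> N" if "r \<in> ?K" for r
    using N[of "\<phi> r"] that by (auto simp: flag_minus_e_def)
  have "flagged_key_poly \<alpha> \<phi> = (\<Sum>c\<in>{c \<in> columns N. \<forall>r. c r \<le> \<phi> r}. col_sum N n ?A c)"
    by (rule flagged_key_poly_eq_col_sum[OF wc n]) (use N in auto)
  also have "\<dots> = (\<Sum>c\<in>{c \<in> columns N. \<forall>r. c r \<le> flag_minus_e \<phi> i r}. col_sum N n ?A c)"
  proof (rule sum.mono_neutral_right)
    show "{c \<in> columns N. \<forall>r. c r \<le> flag_minus_e \<phi> i r} \<subseteq> {c \<in> columns N. \<forall>r. c r \<le> \<phi> r}"
      unfolding flag_minus_e_def using diff_le_self order_trans by blast
    show "\<forall>c\<in>{c \<in> columns N. \<forall>r. c r \<le> \<phi> r} - {c \<in> columns N. \<forall>r. c r \<le> flag_minus_e \<phi> i r}.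
        col_sum N n ?A c = 0"
    proof (rule ballI, rule ccontr)
      fix c assume nz: "col_sum N n ?A c \<noteq> 0"
        and c: "c \<in> {c \<in> columns N. \<forall>r. c r \<le> \<phi> r} - {c \<in> columns N. \<forall>r. c r \<le> flag_minus_e \<phi> i r}"
      then obtain r where r: "c r > flag_minus_e \<phi> i r" by (auto simp: not_le)
      have c\<phi>: "c j \<le> \<phi> j" for j using c by blast
      have "r = i" using r c\<phi>[of r] by (auto simp: flag_minus_e_def split: if_splits)
      then have ci: "c i = \<phi> i" "c i \<noteq> 0" using r c\<phi>[of i] by (auto simp: flag_minus_e_def)
      have "c i \<le> c (Suc i)"
        using col_sum_nonzero_imp_sorted[of ?A i c N n] le nz c by simp
      then have "c i = c (Suc i)" using c\<phi>[of "Suc i"] ci eq by simp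
      then show False using columns_inj[of c N i "Suc i"] c ci(2) by simp
    qed
  qed simp
  also have "\<dots> = flagged_key_poly \<alpha> (flag_minus_e \<phi> i)"
    by (rule flagged_key_poly_eq_col_sum[OF wc n, symmetric]) (use N N' in auto)
  finally show ?thesis .
qed

subsection \<open>Exchanging two adjacent values\<close>

text \<open>
  \<open>base_fits\<close> is what remains of \<open>fits\<close> when \<open>m\<close> and \<open>m + 1\<close> are not distinguished, \<open>val_fits\<close> is the
  part that distinguishes them.
\<close>

definition is_val :: "nat \<Rightarrow> nat \<Rightarrow> bool" where
  "is_val m x \<longleftrightarrow> x = m \<or> x = Suc m"

definition base_fits :: "nat \<Rightarrow> (nat \<Rightarrow> nat) \<Rightarrow> (nat \<Rightarrow> nat) \<Rightarrow> bool" where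
  "base_fits m c d \<longleftrightarrow> (\<forall>r. d r \<le> c r \<or> is_val m (d r) \<and> is_val m (c r)) \<and>
     (\<forall>i k. i < k \<longrightarrow> 0 < c k \<longrightarrow> c k < c i \<longrightarrow>
        c k < d i \<or> is_val m (c k) \<and> (is_val m (c i) \<or> is_val m (d i)))"

definition val_fits :: "nat \<Rightarrow> (nat \<Rightarrow> nat) \<Rightarrow> (nat \<Rightarrow> nat) \<Rightarrow> bool" where
  "val_fits m c d \<longleftrightarrow> (\<forall>r. \<not> (d r = Suc m \<and> c r = m)) \<and>
     (\<forall>i k. i < k \<longrightarrow> is_val m (c k) \<longrightarrow> is_val m (d i) \<longrightarrow> Suc m < c i \<longrightarrow> c k = m \<and> d i = Suc m) \<and>
     (\<forall>i k. i < k \<longrightarrow> c k = m \<longrightarrow> c i = Suc m \<longrightarrow> d i = Suc m)"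

text \<open>The clauses of \<open>val_fits\<close> are the comparisons that merging blurs: a row
  passing from \<open>m\<close> to \<open>Suc m\<close>, condition (c) with \<open>c k\<close> and
  \<open>d i\<close> both among the two values, and (c) with \<open>c k\<close> and
  \<open>c i\<close> both among them. As \<open>m\<close> is positive, neither value is confused
  with the marker 0.\<close>

lemma fits_iff:
  assumes "1 \<le> m"
  shows "fits c d \<longleftrightarrow> base_fits m c d \<and> val_fits m c d"
proof
  assume f: "fits c d"
  then have le: "d r \<le> c r" for r by (simp add: fits_def)
  have less: "c k < d i" if "i < k" "0 < c k" "c k < c i" for i k
    using f that by (simp add: fits_def)
  have "val_fits m c d"
    unfolding val_fits_def
  proof (intro conjI allI impI)
    fix r show "\<not> (d r = Suc m \<and> c r = m)" using le[of r] by auto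
  next
    fix i k assume "i < k" "is_val m (c k)" "is_val m (d i)" "Suc m < c i"
    then show "c k = m" "d i = Suc m"
      using less[of i k] assms by (auto simp: is_val_def)
  next
    fix i k assume "i < k" "c k = m" "c i = Suc m"
    then show "d i = Suc m" using less[of i k] le[of i] assms by simp
  qed
  then show "base_fits m c d \<and> val_fits m c d"
    using le less by (auto simp: base_fits_def)
next
  assume "base_fits m c d \<and> val_fits m c d"
  then have b: "base_fits m c d" and v: "val_fits m c d" by auto
  show "fits c d"
    unfolding fits_def
  proof (intro conjI allI impI)
    fix r
    have "d r \<le> c r \<or> is_val m (d r) \<and> is_val m (c r)" using b by (simp add: base_fits_def)
    moreover have "\<not> (d r = Suc m \<and> c r = m)" using v by (simp add: val_fits_def)
    ultimately show "d r \<le> c r" by (auto simp: is_val_def)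
  next
    fix i k assume ik: "i < k" "0 < c k" "c k < c i"
    have "c k < d i \<or> is_val m (c k) \<and> (is_val m (c i) \<or> is_val m (d i))"
      using b ik by (simp add: base_fits_def)
    moreover have "c k < d i" if "is_val m (c k)" "is_val m (c i)"
    proof -
      have "c k = m" "c i = Suc m" using that ik by (auto simp: is_val_def)
      then show ?thesis using v ik(1) by (simp add: val_fits_def)
    qed
    moreover have "c k < d i" if "is_val m (c k)" "\<not> is_val m (c i)" "is_val m (d i)"
    proof -
      have "Suc m < c i" using that ik by (auto simp: is_val_def)
      then have "c k = m \<and> d i = Suc m" using v ik(1) that unfolding val_fits_def by blast
      then show ?thesis by simp
    qed
    ultimately show "c k < d i" by blast
  qed
qed

lemma is_val_simple_transp [simp]: "is_val m (simple_transp m x) \<longleftrightarrow> is_val m x"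
  by (auto simp: is_val_def simple_transp_def transpose_def)

lemma simple_transp_eq_iff [simp]:
  "simple_transp m x = m \<longleftrightarrow> x = Suc m" "simple_transp m x = Suc m \<longleftrightarrow> x = m"
  by (auto simp: simple_transp_def transpose_def)

lemma simple_transp_less_iff:
  assumes "\<not> (is_val m x \<and> is_val m y)"
  shows "simple_transp m x < simple_transp m y \<longleftrightarrow> x < y"
  using assms by (auto simp: is_val_def simple_transp_def transpose_def)

lemma simple_transp_not_val: "\<not> is_val m x \<Longrightarrow> simple_transp m x = x"
  by (auto simp: is_val_def simple_transp_def)

lemma simple_transp_pos_iff [simp]: "1 \<le> m \<Longrightarrow> 0 < simple_transp m x \<longleftrightarrow> 0 < x"
  by (auto simp: simple_transp_def transpose_def)

lemma base_fits_swap_left_imp: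
  assumes m: "1 \<le> m" and b: "base_fits m c d"
  shows "base_fits m (simple_transp m \<circ> c) d"
  unfolding base_fits_def comp_apply
proof (intro conjI allI impI)
  fix r
  have "d r \<le> c r \<or> is_val m (d r) \<and> is_val m (c r)" using b by (simp add: base_fits_def)
  then show "d r \<le> simple_transp m (c r) \<or> is_val m (d r) \<and> is_val m (simple_transp m (c r))"
    by (auto simp: is_val_def simple_transp_def transpose_def)
next
  fix i k
  assume ik: "i < k" "0 < simple_transp m (c k)" "simple_transp m (c k) < simple_transp m (c i)"
  show "simple_transp m (c k) < d i \<or> is_val m (simple_transp m (c k)) \<and>
      (is_val m (simple_transp m (c i)) \<or> is_val m (d i))"
  proof (cases "is_val m (c k) \<and> is_val m (c i)")
    case False
    then have "c k < c i" using ik(3) simple_transp_less_iff by blast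
    then have "c k < d i \<or> is_val m (c k) \<and> (is_val m (c i) \<or> is_val m (d i))"
      using b ik(1,2) m by (simp add: base_fits_def)
    then show ?thesis
      by (auto simp: is_val_def simple_transp_def transpose_def)
  qed simp
qed

lemma base_fits_swap_right_imp:
  assumes b: "base_fits m c d"
  shows "base_fits m c (simple_transp m \<circ> d)"
  unfolding base_fits_def comp_apply
proof (intro conjI allI impI)
  fix r
  have "d r \<le> c r \<or> is_val m (d r) \<and> is_val m (c r)" using b by (simp add: base_fits_def)
  then show "simple_transp m (d r) \<le> c r \<or> is_val m (simple_transp m (d r)) \<and> is_val m (c r)"
    by (auto simp: is_val_def simple_transp_def transpose_def)
next
  fix i k
  assume "i < k" "0 < c k" "c k < c i"
  then have "c k < d i \<or> is_val m (c k) \<and> (is_val m (c i) \<or> is_val m (d i))"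
    using b by (simp add: base_fits_def)
  then show "c k < simple_transp m (d i) \<or> is_val m (c k) \<and>
      (is_val m (c i) \<or> is_val m (simple_transp m (d i)))"
    by (auto simp: is_val_def simple_transp_def transpose_def)
qed

lemma swap_vals_involutory [simp]: "simple_transp m \<circ> (simple_transp m \<circ> c) = c"
  by (simp add: fun_eq_iff)

lemma base_fits_swap:
  assumes "1 \<le> m"
  shows "base_fits m (simple_transp m \<circ> c) d \<longleftrightarrow> base_fits m c d"
    and "base_fits m c (simple_transp m \<circ> d) \<longleftrightarrow> base_fits m c d"
  using base_fits_swap_left_imp[OF assms, of c d]
    base_fits_swap_left_imp[OF assms, of "simple_transp m \<circ> c" d]
    base_fits_swap_right_imp[of m c d] base_fits_swap_right_imp[of m c "simple_transp m \<circ> d"]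
  unfolding swap_vals_involutory by blast+

text \<open>Supplies the premise \<open>Suc m < c i\<close> in the second clause of
  \<open>val_fits\<close> for rows that take a merged value only in the right-hand column.\<close>

lemma above_of_base_fits:
  assumes "base_fits m c d" "is_val m (d i)" "\<not> is_val m (c i)"
  shows "Suc m < c i"
proof -
  have "d i \<le> c i" using assms by (auto simp: base_fits_def)
  then show ?thesis using assms(2,3) by (auto simp: is_val_def)
qed

text \<open>
  A representative of the orbit of a column under exchanging the values \<open>m\<close> and \<open>m + 1\<close>.
\<close>

definition low_first :: "nat \<Rightarrow> (nat \<Rightarrow> nat) \<Rightarrow> bool" where
  "low_first m c \<longleftrightarrow> (\<forall>r. c r = Suc m \<longrightarrow> (\<exists>s<r. c s = m))"

section \<open>Transfer matrices between orbits of columns\<close>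

lemma fits_no_val:
  assumes m: "1 \<le> m" and no: "\<And>r. \<not> is_val m (c r)"
  shows "fits c (simple_transp m \<circ> d) \<longleftrightarrow> fits c d"
proof -
  have c: "c r \<noteq> m" "c r \<noteq> Suc m" for r using no[of r] by (auto simp: is_val_def)
  have "val_fits m c e" for e using c no by (simp add: val_fits_def)
  then show ?thesis using fits_iff[OF m] base_fits_swap[OF m] by simp
qed

text \<open>Row \<open>p\<close> carries the only merged value of \<open>c\<close>, so the third
  clause of \<open>val_fits\<close> is vacuous. A merged value of \<open>d\<close> in an earlier row
  has come down from above \<open>Suc m\<close>, and the second clause with \<open>k = p\<close>
  admits it only as \<open>Suc m\<close>.\<close>

lemma val_fits_single:
  assumes b: "base_fits m c d" and p: "c p = m" "\<And>r. is_val m (c r) \<Longrightarrow> r = p"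
  shows "val_fits m c d \<longleftrightarrow> d p \<noteq> Suc m \<and> (\<forall>i<p. d i \<noteq> m)"
proof
  assume v: "val_fits m c d"
  have "d i \<noteq> m" if "i < p" for i
  proof
    assume di: "d i = m"
    have "Suc m < c i"
      by (rule above_of_base_fits[OF b]) (use di p(2)[of i] that in \<open>auto simp: is_val_def\<close>)
    moreover have "is_val m (c p)" "is_val m (d i)" using p di by (simp_all add: is_val_def)
    ultimately have "d i = Suc m" using v that unfolding val_fits_def by blast
    then show False using di by simp
  qed
  then show "d p \<noteq> Suc m \<and> (\<forall>i<p. d i \<noteq> m)" using v p by (auto simp: val_fits_def)
next
  assume R: "d p \<noteq> Suc m \<and> (\<forall>i<p. d i \<noteq> m)"
  show "val_fits m c d"
    unfolding val_fits_def
  proof (intro conjI allI impI)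
    fix r show "\<not> (d r = Suc m \<and> c r = m)" using R p(2)[of r] by (auto simp: is_val_def)
  next
    fix i k assume "i < k" "is_val m (c k)" "is_val m (d i)"
    moreover from this have "k = p" using p by simp
    ultimately show "c k = m" "d i = Suc m" using R p by (auto simp: is_val_def)
  next
    fix i k assume "i < k" "c k = m" "c i = Suc m"
    then show "d i = Suc m" using p(2)[of i] p(2)[of k] by (simp add: is_val_def)
  qed
qed

text \<open>The conclusion of the second clause with \<open>k = p\<close> asks for
  \<open>c p = m\<close> and cannot hold here, so no earlier row of \<open>d\<close> may carry a
  merged value.\<close>

lemma val_fits_single_high:
  assumes b: "base_fits m c d" and p: "c p = Suc m" "\<And>r. is_val m (c r) \<Longrightarrow> r = p"
  shows "val_fits m c d \<longleftrightarrow> (\<forall>i<p. \<not> is_val m (d i))"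
proof
  assume v: "val_fits m c d"
  have "\<not> is_val m (d i)" if "i < p" for i
  proof
    assume di: "is_val m (d i)"
    have "Suc m < c i"
      by (rule above_of_base_fits[OF b]) (use di p(2)[of i] that in auto)
    moreover have "is_val m (c p)" using p by (simp add: is_val_def)
    ultimately have "c p = m" using v that di unfolding val_fits_def by blast
    then show False using p by simp
  qed
  then show "\<forall>i<p. \<not> is_val m (d i)" by blast
next
  assume R: "\<forall>i<p. \<not> is_val m (d i)"
  show "val_fits m c d"
    unfolding val_fits_def
  proof (intro conjI allI impI)
    fix r show "\<not> (d r = Suc m \<and> c r = m)" using p(1) p(2)[of r] by (auto simp: is_val_def)
  next
    fix i k assume "i < k" "is_val m (c k)" "is_val m (d i)"
    moreover from this have "k = p" using p by simp
    ultimately show "c k = m" "d i = Suc m" using R by auto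
  next
    fix i k assume "i < k" "c k = m" "c i = Suc m"
    then show "d i = Suc m" using p(2)[of i] p(2)[of k] by (simp add: is_val_def)
  qed
qed

text \<open>The four alternatives are the transfer matrices that are full, zero, triangular, and strictly triangular.\<close>

lemma fits_single:
  assumes m: "1 \<le> m" and p: "c p = m" "\<And>r. is_val m (c r) \<Longrightarrow> r = p" and d: "low_first m d"
  defines "c' \<equiv> simple_transp m \<circ> c" and "d' \<equiv> simple_transp m \<circ> d"
  shows "fits c d \<and> fits c d' \<and> fits c' d \<and> fits c' d' \<or>
    \<not> fits c d \<and> \<not> fits c d' \<and> \<not> fits c' d \<and> \<not> fits c' d' \<or>
    fits c d \<and> \<not> fits c d' \<and> fits c' d \<and> fits c' d' \<or>
    \<not> fits c d \<and> fits c d' \<and> \<not> fits c' d \<and> \<not> fits c' d'"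
proof (cases "base_fits m c d")
  case False
  then show ?thesis
    using base_fits_swap[OF m] fits_iff[OF m] unfolding c'_def d'_def by blast
next
  case True
  then have b: "base_fits m c d" "base_fits m c d'" "base_fits m c' d" "base_fits m c' d'"
    using base_fits_swap[OF m] unfolding c'_def d'_def by blast+
  have p': "c' p = Suc m" "\<And>r. is_val m (c' r) \<Longrightarrow> r = p"
    using p by (simp_all add: c'_def simple_transp_apply)
  have fc: "fits c e \<longleftrightarrow> e p \<noteq> Suc m \<and> (\<forall>i<p. e i \<noteq> m)" if "base_fits m c e" for e
    using val_fits_single[OF that p] fits_iff[OF m] that by blast
  have fc': "fits c' e \<longleftrightarrow> (\<forall>i<p. \<not> is_val m (e i))" if "base_fits m c' e" for e
    using val_fits_single_high[OF that p'] fits_iff[OF m] that by blast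
  have dd': "is_val m (d' i) \<longleftrightarrow> is_val m (d i)" "d' i = m \<longleftrightarrow> d i = Suc m" "d' i = Suc m \<longleftrightarrow> d i = m" for i
    by (simp_all add: d'_def)
  show ?thesis
  \<comment> \<open>If \<open>d\<close> has a merged value before row \<open>p\<close>, it has an
    \<open>m\<close> there, being low first: then at most \<open>d'\<close> can follow
    \<open>c\<close>, and neither column follows \<open>c'\<close>. Otherwise \<open>c'\<close>
    admits both columns and \<open>c\<close> admits \<open>d\<close>.\<close>
  proof (cases "\<exists>i<p. is_val m (d i)")
    case True
    then obtain j where j: "j < p" "d j = m \<or> d j = Suc m" by (auto simp: is_val_def)
    then obtain i where "i < p" "d i = m"
      using d unfolding low_first_def by (metis less_trans)
    then have "\<not> fits c d" using fc b by blast
    moreover have "\<not> fits c' d" "\<not> fits c' d'" using True fc' b dd' by blast+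
    ultimately show ?thesis by blast
  next
    case False
    then have "fits c' d" "fits c' d'" using fc' b dd' by blast+
    moreover have "fits c d"
    proof -
      have "d p \<noteq> Suc m" using d False unfolding low_first_def is_val_def by blast
      then show ?thesis using fc[OF b(1)] False by (auto simp: is_val_def)
    qed
    ultimately show ?thesis by blast
  qed
qed

text \<open>The order of \<open>p\<close> and \<open>q\<close> makes the third clause vacuous. The
  second clause with \<open>k = q\<close> forbids merged values of \<open>d\<close> before
  \<open>q\<close> except in row \<open>p\<close>, where \<open>c\<close> itself is merged; this
  covers the demands of \<open>k = p\<close>.\<close>

lemma val_fits_double:
  assumes b: "base_fits m c d" and pq: "p < q" "c p = m" "c q = Suc m"
    and only: "\<And>r. is_val m (c r) \<Longrightarrow> r = p \<or> r = q"
  shows "val_fits m c d \<longleftrightarrow> d p \<noteq> Suc m \<and> (\<forall>i<q. i \<noteq> p \<longrightarrow> \<not> is_val m (d i))"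
proof
  assume v: "val_fits m c d"
  have "\<not> is_val m (d i)" if "i < q" "i \<noteq> p" for i
  proof
    assume di: "is_val m (d i)"
    have "Suc m < c i"
      by (rule above_of_base_fits[OF b]) (use di only[of i] that in auto)
    moreover have "is_val m (c q)" using pq by (simp add: is_val_def)
    ultimately have "c q = m" using v that(1) di unfolding val_fits_def by blast
    then show False using pq by simp
  qed
  then show "d p \<noteq> Suc m \<and> (\<forall>i<q. i \<noteq> p \<longrightarrow> \<not> is_val m (d i))"
    using v pq by (auto simp: val_fits_def)
next
  assume R: "d p \<noteq> Suc m \<and> (\<forall>i<q. i \<noteq> p \<longrightarrow> \<not> is_val m (d i))"
  show "val_fits m c d"
    unfolding val_fits_def
  proof (intro conjI allI impI)
    fix r show "\<not> (d r = Suc m \<and> c r = m)"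
      using R pq only[of r] by (auto simp: is_val_def)
  next
    fix i k assume ik: "i < k" "is_val m (c k)" "is_val m (d i)" "Suc m < c i"
    then have "k \<le> q" "i \<noteq> p" using only[of k] pq by auto
    then have False using R ik by (meson order_less_le_trans)
    then show "c k = m" "d i = Suc m" by auto
  next
    fix i k assume ik: "i < k" "c k = m" "c i = Suc m"
    then have "k = p" "i = q" using only[of k] only[of i] pq by (auto simp: is_val_def)
    then show "d i = Suc m" using ik pq by simp
  qed
qed

text \<open>The third clause forces \<open>d p = Suc m\<close>. By distinctness no other row of
  \<open>d\<close> has \<open>Suc m\<close>, so the second clause with \<open>k = q\<close> excludes
  merged values from the other rows before \<open>q\<close>.\<close>

lemma val_fits_double_high:
  assumes b: "base_fits m c d" and pq: "p < q" "c p = Suc m" "c q = m"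
    and only: "\<And>r. is_val m (c r) \<Longrightarrow> r = p \<or> r = q" and inj: "\<And>r s. d r = Suc m \<Longrightarrow> d s = Suc m \<Longrightarrow> r = s"
  shows "val_fits m c d \<longleftrightarrow> d p = Suc m \<and> (\<forall>i<q. i \<noteq> p \<longrightarrow> \<not> is_val m (d i))"
proof
  assume v: "val_fits m c d"
  then have dp: "d p = Suc m" using pq by (simp add: val_fits_def)
  have "\<not> is_val m (d i)" if "i < q" "i \<noteq> p" for i
  proof
    assume di: "is_val m (d i)"
    have "Suc m < c i"
      by (rule above_of_base_fits[OF b]) (use di only[of i] that in auto)
    moreover have "is_val m (c q)" using pq by (simp add: is_val_def)
    ultimately have "d i = Suc m" using v that(1) di unfolding val_fits_def by blast
    then show False using inj[OF dp] that by blast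
  qed
  then show "d p = Suc m \<and> (\<forall>i<q. i \<noteq> p \<longrightarrow> \<not> is_val m (d i))"
    using dp by blast
next
  assume R: "d p = Suc m \<and> (\<forall>i<q. i \<noteq> p \<longrightarrow> \<not> is_val m (d i))"
  show "val_fits m c d"
    unfolding val_fits_def
  proof (intro conjI allI impI)
    fix r show "\<not> (d r = Suc m \<and> c r = m)"
      using R pq only[of r] inj[of p r] by (auto simp: is_val_def)
  next
    fix i k assume ik: "i < k" "is_val m (c k)" "is_val m (d i)" "Suc m < c i"
    then have "k \<le> q" "i \<noteq> p" using only[of k] pq by auto
    then have False using R ik by (meson order_less_le_trans)
    then show "c k = m" "d i = Suc m" by auto
  next
    fix i k assume ik: "i < k" "c k = m" "c i = Suc m"
    then have "i = p" using only[of i] pq by (auto simp: is_val_def)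
    then show "d i = Suc m" using R by simp
  qed
qed

text \<open>All four conditions share \<open>?Q\<close> and differ only in \<open>d p\<close>. As
  \<open>d\<close> is low first, \<open>?Q\<close> excludes \<open>d p = Suc m\<close>. Given
  \<open>?Q\<close>, \<open>d p = m\<close> yields the identity matrix and an unmerged
  \<open>d p\<close> the matrix that adds both components into the first; without \<open>?Q\<close>
  the matrix is zero.\<close>

lemma fits_double:
  assumes m: "1 \<le> m" and pq: "p < q" "c p = m" "c q = Suc m"
    and only: "\<And>r. is_val m (c r) \<Longrightarrow> r = p \<or> r = q" and d: "low_first m d" "d \<in> columns N"
  defines "c' \<equiv> simple_transp m \<circ> c" and "d' \<equiv> simple_transp m \<circ> d"
  shows "fits c d \<and> fits c d' \<and> \<not> fits c' d \<and> \<not> fits c' d' \<or>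
    fits c d \<and> \<not> fits c d' \<and> \<not> fits c' d \<and> fits c' d' \<or>
    \<not> fits c d \<and> \<not> fits c d' \<and> \<not> fits c' d \<and> \<not> fits c' d'"
proof (cases "base_fits m c d")
  case False
  then show ?thesis
    using base_fits_swap[OF m] fits_iff[OF m] unfolding c'_def d'_def by blast
next
  case True
  then have b: "base_fits m c d" "base_fits m c d'" "base_fits m c' d" "base_fits m c' d'"
    using base_fits_swap[OF m] unfolding c'_def d'_def by blast+
  have pq': "c' p = Suc m" "c' q = m" "\<And>r. is_val m (c' r) \<Longrightarrow> r = p \<or> r = q"
    using pq only by (simp_all add: c'_def simple_transp_apply)
  have inj: "d r = x \<Longrightarrow> d s = x \<Longrightarrow> is_val m x \<Longrightarrow> r = s" for r s x
    using columns_inj[OF d(2), of r s] m by (auto simp: is_val_def)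
  have inj_Suc: "d r = Suc m \<Longrightarrow> d s = Suc m \<Longrightarrow> r = s" for r s
    using inj[of r "Suc m" s] by (simp add: is_val_def)
  have inj': "d' r = Suc m \<Longrightarrow> d' s = Suc m \<Longrightarrow> r = s" for r s
    using inj[of r m s] by (simp add: d'_def is_val_def)
  let ?Q = "\<forall>i<q. i \<noteq> p \<longrightarrow> \<not> is_val m (d i)"
  have dd': "is_val m (d' i) \<longleftrightarrow> is_val m (d i)" "d' i = Suc m \<longleftrightarrow> d i = m" for i
    by (simp_all add: d'_def)
  have "fits c d \<longleftrightarrow> d p \<noteq> Suc m \<and> ?Q"
    using val_fits_double[OF b(1) pq only] fits_iff[OF m] b by blast
  moreover have "fits c d' \<longleftrightarrow> d p \<noteq> m \<and> ?Q"
    using val_fits_double[OF b(2) pq only] fits_iff[OF m] b dd' by blast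
  moreover have "fits c' d \<longleftrightarrow> d p = Suc m \<and> ?Q"
    using val_fits_double_high[OF b(3) pq(1) pq' inj_Suc] fits_iff[OF m] b by blast
  moreover have "fits c' d' \<longleftrightarrow> d p = m \<and> ?Q"
    using val_fits_double_high[OF b(4) pq(1) pq' inj'] fits_iff[OF m] b dd' by blast
  moreover have "\<not> (d p = Suc m \<and> ?Q)"
  proof
    assume R: "d p = Suc m \<and> ?Q"
    then obtain s where "s < p" "d s = m" using d(1) unfolding low_first_def by blast
    then show False using R pq(1) by (auto simp: is_val_def)
  qed
  ultimately show ?thesis by auto
qed

section \<open>Pairs of polynomials related by a Demazure operator\<close>

text \<open>Equivalent to \<open>f + g = pi_op m f\<close>, but stated without a quotient; the
  symmetric \<open>h\<close> is the divided difference of \<open>f\<close>.\<close>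

definition dem_pair :: "nat \<Rightarrow> ipoly \<Rightarrow> ipoly \<Rightarrow> bool" where
  "dem_pair m f g \<longleftrightarrow> swap_vars m (f + g) = f + g \<and>
     (\<exists>h. swap_vars m h = h \<and> g = var (Suc m) * h)"

lemma swap_vars_var_apply:
  "swap_vars m (var m) = var (Suc m)" "swap_vars m (var (Suc m)) = var m"
  by (simp_all add: swap_vars_var simple_transp_apply)

lemma dem_pair_0: "dem_pair m 0 0"
  unfolding dem_pair_def by (auto intro: exI[of _ 0])

lemma dem_pair_add:
  assumes "dem_pair m f g" "dem_pair m f' g'"
  shows "dem_pair m (f + f') (g + g')"
proof -
  obtain h h' where h: "swap_vars m h = h" "g = var (Suc m) * h" "swap_vars m h' = h'"
    "g' = var (Suc m) * h'"
    using assms unfolding dem_pair_def by blast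
  have "swap_vars m ((f + g) + (f' + g')) = (f + g) + (f' + g')"
    using assms unfolding dem_pair_def swap_vars_add[of m "f + g"] by simp
  moreover have "f + f' + (g + g') = (f + g) + (f' + g')" by (simp add: algebra_simps)
  moreover have "swap_vars m (h + h') = h + h'" "g + g' = var (Suc m) * (h + h')"
    using h by (simp_all add: swap_vars_add distrib_left)
  ultimately show ?thesis unfolding dem_pair_def by metis
qed

lemma dem_pair_sum:
  "(\<And>x. x \<in> X \<Longrightarrow> dem_pair m (f x) (g x)) \<Longrightarrow> dem_pair m (sum f X) (sum g X)"
  by (induction X rule: infinite_finite_induct) (simp_all add: dem_pair_0 dem_pair_add)

lemma dem_pair_mult:
  assumes "swap_vars m u = u" "dem_pair m f g"
  shows "dem_pair m (u * f) (u * g)"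
proof -
  obtain h where h: "swap_vars m h = h" "g = var (Suc m) * h"
    using assms(2) unfolding dem_pair_def by blast
  have "swap_vars m (u * f + u * g) = u * f + u * g"
    using assms unfolding dem_pair_def distrib_left[symmetric] swap_vars_mult by simp
  moreover have "swap_vars m (u * h) = u * h" "u * g = var (Suc m) * (u * h)"
    using h assms(1) by (simp_all add: swap_vars_mult algebra_simps)
  ultimately show ?thesis unfolding dem_pair_def by blast
qed

lemma dem_pair_symmetric: "swap_vars m f = f \<Longrightarrow> dem_pair m f 0"
  unfolding dem_pair_def by (auto intro: exI[of _ 0])

lemma dem_pair_all:
  assumes "dem_pair m f g"
  shows "dem_pair m (var m * (f + g)) (var (Suc m) * (f + g))"
proof -
  have s: "swap_vars m (f + g) = f + g" using assms by (simp add: dem_pair_def)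
  have "swap_vars m (var m * (f + g) + var (Suc m) * (f + g)) =
      var m * (f + g) + var (Suc m) * (f + g)"
    unfolding swap_vars_add[of m "var m * (f + g)"] swap_vars_mult swap_vars_var_apply s by (rule add.commute)
  then show ?thesis unfolding dem_pair_def using s by blast
qed

text \<open>The two components add up to \<open>(var m + var (Suc m)) * (f + g)\<close> less
  \<open>var m * g\<close>, and the factor \<open>var (Suc m)\<close> of \<open>g\<close> completes
  \<open>var m\<close> to a symmetric product.\<close>

lemma dem_pair_lower:
  assumes "dem_pair m f g"
  shows "dem_pair m (var m * f) (var (Suc m) * (f + g))"
proof -
  obtain h where s: "swap_vars m (f + g) = f + g" and h: "swap_vars m h = h" "g = var (Suc m) * h"
    using assms unfolding dem_pair_def by blast
  have "var m * f + var (Suc m) * (f + g) =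
      (var m + var (Suc m)) * (f + g) - var m * var (Suc m) * h"
    unfolding h(2) by (simp add: algebra_simps)
  moreover have "swap_vars m ((var m + var (Suc m)) * (f + g) - var m * var (Suc m) * h) =
      (var m + var (Suc m)) * (f + g) - var m * var (Suc m) * h"
    unfolding swap_vars_diff swap_vars_mult s h(1) swap_vars_add[of m "var m"] swap_vars_var_apply
    by (simp only: ac_simps)
  ultimately show ?thesis unfolding dem_pair_def using s by metis
qed

text \<open>\<open>g\<close> is \<open>var (Suc m)\<close> times a symmetric polynomial, so the
  factor \<open>var m\<close> makes it symmetric.\<close>

lemma dem_pair_upper:
  assumes "dem_pair m f g"
  shows "dem_pair m (var m * g) 0"
proof -
  obtain h where h: "swap_vars m h = h" "g = var (Suc m) * h"
    using assms unfolding dem_pair_def by blast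
  show ?thesis
    unfolding h(2)
    by (rule dem_pair_symmetric) (simp add: swap_vars_mult swap_vars_var_apply h(1) algebra_simps)
qed

lemma dem_pair_merge: "dem_pair m f g \<Longrightarrow> dem_pair m (f + g) 0"
  by (rule dem_pair_symmetric) (simp add: dem_pair_def)

abbreviation entry_var :: "nat \<Rightarrow> ipoly" where
  "entry_var x \<equiv> if x = 0 then 1 else var x"

lemma swap_vars_entry_var_eq:
  "1 \<le> m \<Longrightarrow> \<not> is_val m x \<Longrightarrow> swap_vars m (entry_var x) = entry_var x"
  by (simp add: swap_vars_var simple_transp_not_val)

lemma swap_vars_partial_wt:
  assumes "1 \<le> m" "\<And>r. r \<in> R \<Longrightarrow> \<not> is_val m (c r)"
  shows "swap_vars m (\<Prod>r\<in>R. entry_var (c r)) = (\<Prod>r\<in>R. entry_var (c r))"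
  unfolding swap_vars_prod by (rule prod.cong[OF refl], rule swap_vars_entry_var_eq) (use assms in auto)

lemma partial_wt_swap_vals:
  assumes "\<And>r. r \<in> R \<Longrightarrow> \<not> is_val m (c r)"
  shows "(\<Prod>r\<in>R. entry_var ((simple_transp m \<circ> c) r)) = (\<Prod>r\<in>R. entry_var (c r))"
  by (rule prod.cong[OF refl]) (use assms in \<open>simp add: simple_transp_not_val\<close>)

lemma columns_in_range: "c \<in> columns N \<Longrightarrow> c r \<noteq> 0 \<Longrightarrow> r \<in> {1..N}"
  unfolding columns_def by blast

lemma columns_swap_vals:
  assumes "1 \<le> m" "Suc m \<le> N" "c \<in> columns N"
  shows "simple_transp m \<circ> c \<in> columns N"
  unfolding columns_def mem_Collect_eq comp_apply
proof (intro conjI allI impI)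
  fix r assume nz: "simple_transp m (c r) \<noteq> 0"
  then have "c r \<noteq> 0" using simple_transp_pos_iff[OF assms(1), of "c r"] by simp
  then have c: "r \<in> {1..N}" "c r \<in> {1..N}" using assms(3) by (auto simp: columns_def)
  then show "r \<in> {1..N}" by simp
  show "simple_transp m (c r) \<le> N"
    using permutes_in_image[OF simple_transp_permutes[OF assms(1,2)], of "c r"] c by simp
next
  fix r s assume "simple_transp m (c r) = simple_transp m (c s)" "simple_transp m (c r) \<noteq> 0"
  then have "c r = c s" "c r \<noteq> 0"
    using simple_transp_pos_iff[OF assms(1), of "c r"]
    by (metis simple_transp_involutory, simp)
  then show "r = s" using columns_inj[OF assms(3)] by blast
qed

lemma swap_vals_eq_iff: "simple_transp m \<circ> c = c \<longleftrightarrow> (\<forall>r. \<not> is_val m (c r))"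
proof
  assume eq: "simple_transp m \<circ> c = c"
  show "\<forall>r. \<not> is_val m (c r)"
  proof
    fix r
    have "simple_transp m (c r) = c r" using fun_cong[OF eq, of r] by simp
    then show "\<not> is_val m (c r)"
      using simple_transp_eq_iff[of m "c r"] unfolding is_val_def by (metis n_not_Suc_n)
  qed
qed (simp add: fun_eq_iff simple_transp_not_val)

text \<open>With both values present, the exchange reverses the order of their rows; with only one
  present, being low first means that it is \<open>m\<close>.\<close>

lemma low_first_swap_vals:
  assumes c: "c \<in> columns N" and m: "1 \<le> m" and ne: "simple_transp m \<circ> c \<noteq> c"
  shows "low_first m (simple_transp m \<circ> c) \<longleftrightarrow> \<not> low_first m c"
proof -
  have inj: "r = s" if "c r = x" "c s = x" "x = m \<or> x = Suc m" for r s x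
    using columns_inj[OF c, of r s] that m by auto
  have L: "low_first m c \<longleftrightarrow> (\<forall>r. c r = Suc m \<longrightarrow> (\<exists>s<r. c s = m))"
    "low_first m (simple_transp m \<circ> c) \<longleftrightarrow> (\<forall>r. c r = m \<longrightarrow> (\<exists>s<r. c s = Suc m))"
    by (simp_all add: low_first_def)
  obtain r where r: "c r = m \<or> c r = Suc m"
    using ne by (auto simp: swap_vals_eq_iff is_val_def)
  show ?thesis
  proof (cases "\<exists>p q. c p = m \<and> c q = Suc m")
    case True
    then obtain p q where pq: "c p = m" "c q = Suc m" by blast
    have "low_first m c \<longleftrightarrow> p < q" unfolding L using pq inj by metis
    moreover have "low_first m (simple_transp m \<circ> c) \<longleftrightarrow> q < p" unfolding L using pq inj by metis
    moreover have "p \<noteq> q" using pq by auto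
    ultimately show ?thesis by auto
  next
    case False
    then show ?thesis unfolding L using r by metis
  qed
qed

lemma low_first_of_fixed: "simple_transp m \<circ> c = c \<Longrightarrow> low_first m c"
  by (simp add: swap_vals_eq_iff low_first_def is_val_def)

lemma low_first_cases:
  assumes c: "c \<in> columns N" "low_first m c" and m: "1 \<le> m"
  obtains (none) "\<And>r. \<not> is_val m (c r)"
  | (single) p where "c p = m" "\<And>r. is_val m (c r) \<Longrightarrow> r = p"
  | (double) p q where "p < q" "c p = m" "c q = Suc m" "\<And>r. is_val m (c r) \<Longrightarrow> r = p \<or> r = q"
proof (cases "\<exists>p. c p = m")
  case False
  then have "\<not> is_val m (c r)" for r
    using c(2) unfolding low_first_def is_val_def by blast
  then show ?thesis by (rule none)
next
  case True
  then obtain p where p: "c p = m" by blast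
  have inj: "r = s" if "c r = x" "c s = x" "x = m \<or> x = Suc m" for r s x
    using columns_inj[OF c(1), of r s] that m by auto
  show ?thesis
  proof (cases "\<exists>q. c q = Suc m")
    case False
    show ?thesis
    proof (rule single[OF p])
      fix r assume "is_val m (c r)"
      then show "r = p" using False p inj unfolding is_val_def by metis
    qed
  next
    case True
    then obtain q where q: "c q = Suc m" by blast
    then obtain s where "s < q" "c s = m" using c(2) unfolding low_first_def by blast
    then have "p < q" using inj p by metis
    then show ?thesis
    proof (rule double[OF _ p q])
      fix r assume "is_val m (c r)"
      then show "r = p \<or> r = q" using p q inj unfolding is_val_def by metis
    qed
  qed
qed

text \<open>The truth values form the transfer matrix: \<open>x1\<close> and \<open>x2\<close>
  belong to the column containing \<open>m\<close>, \<open>x3\<close> and \<open>x4\<close> to the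
  one containing \<open>Suc m\<close>, each against the two arrangements of the next column.\<close>

lemma dem_pair_single_step:
  assumes "dem_pair m f g"
    and "x1 \<and> x2 \<and> x3 \<and> x4 \<or> \<not> x1 \<and> \<not> x2 \<and> \<not> x3 \<and> \<not> x4 \<or> x1 \<and> \<not> x2 \<and> x3 \<and> x4 \<or>
      \<not> x1 \<and> x2 \<and> \<not> x3 \<and> \<not> x4"
  shows "dem_pair m (var m * ((if x1 then f else 0) + (if x2 then g else 0)))
    (var (Suc m) * ((if x3 then f else 0) + (if x4 then g else 0)))"
  using assms(2) dem_pair_all[OF assms(1)] dem_pair_0[of m] dem_pair_lower[OF assms(1)]
    dem_pair_upper[OF assms(1)] by (cases x1; cases x2; cases x3; cases x4) simp_all

text \<open>No weights appear because a column with both values has the symmetric factor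
  \<open>var m * var (Suc m)\<close> in either arrangement, which is split off separately.\<close>

lemma dem_pair_double_step:
  assumes "dem_pair m f g"
    and "x1 \<and> x2 \<and> \<not> x3 \<and> \<not> x4 \<or> x1 \<and> \<not> x2 \<and> \<not> x3 \<and> x4 \<or> \<not> x1 \<and> \<not> x2 \<and> \<not> x3 \<and> \<not> x4"
  shows "dem_pair m ((if x1 then f else 0) + (if x2 then g else 0))
    ((if x3 then f else 0) + (if x4 then g else 0))"
  using assms dem_pair_merge[OF assms(1)] dem_pair_0[of m]
  by (cases x1; cases x2; cases x3; cases x4) simp_all

text \<open>Induction on the number of columns. The next columns are grouped into orbits under
  exchanging the values, and the pair that belongs to an orbit by induction passes through one of
  the transfer matrices. Adding over orbits and multiplying by a symmetric weight preserve
  \<open>dem_pair\<close>.\<close>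

lemma col_sum_dem_pair:
  assumes m: "1 \<le> m" "Suc m \<le> N" and "c \<in> columns N" "low_first m c"
  shows "dem_pair m (col_sum N n A c)
    (if simple_transp m \<circ> c = c then 0 else col_sum N n A (simple_transp m \<circ> c))"
  using assms(3,4)
proof (induction n arbitrary: A c)
  case 0
  show ?case
  proof (cases "c = (\<lambda>_. 0)")
    case True
    then have "\<not> is_val m (c r)" for r using m(1) by (simp add: is_val_def)
    then have "simple_transp m \<circ> c = c" by (simp add: swap_vals_eq_iff)
    then show ?thesis using True dem_pair_symmetric[of m 1] by (simp only: col_sum.simps) simp
  next
    case False
    then obtain r where "0 < c r" by auto
    then have "0 < (simple_transp m \<circ> c) r" using simple_transp_pos_iff[OF m(1)] by simp
    then have "simple_transp m \<circ> c \<noteq> (\<lambda>_. 0)" by (metis less_irrefl)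
    then show ?thesis using False by (simp only: col_sum.simps if_False if_cancel dem_pair_0)
  qed
next
  case (Suc n)
  let ?s = "simple_transp m"
  define Z where "Z = col_sum N n (\<lambda>r. A r - 1)"
  \<comment> \<open>The value 0 is for orbits of a single column, which would otherwise be counted
    twice.\<close>
  define g where "g d = (if ?s \<circ> d = d then 0 else Z (?s \<circ> d))" for d
  define G where "G e = (\<Sum>d\<in>columns N. if fits e d then Z d else 0)" for e
  let ?D = "{d \<in> columns N. low_first m d}"
  have dem: "dem_pair m (Z d) (g d)" if "d \<in> ?D" for d
    using Suc.IH[of d "\<lambda>r. A r - 1"] that unfolding Z_def g_def by blast
  have col: "col_sum N (Suc n) A e =
      (if \<forall>r. e r \<noteq> 0 \<longleftrightarrow> A r \<noteq> 0 then col_wt N e * G e else 0)" for e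
    by (simp only: col_sum.simps G_def Z_def)
  have G: "G e = (\<Sum>d\<in>?D. (if fits e d then Z d else 0) + (if fits e (?s \<circ> d) then g d else 0))" for e
  proof -
    have "G e = (\<Sum>d\<in>?D. (if fits e d then Z d else 0) +
        (if ?s \<circ> d = d then 0 else if fits e (?s \<circ> d) then Z (?s \<circ> d) else 0))"
      unfolding G_def
    proof (rule sum_involution)
      show "finite (columns N)" by (rule finite_columns)
      show "?s \<circ> (?s \<circ> d) = d" for d by (rule swap_vals_involutory)
    qed (use columns_swap_vals m low_first_swap_vals low_first_of_fixed in blast)+
    moreover have "(if P then 0 else if Q then z else 0) = (if Q then if P then 0 else z else 0)"
      for P Q and z :: ipoly by simp
    ultimately show ?thesis unfolding g_def by (simp only:)
  qed
  have supp: "(\<forall>r. (?s \<circ> c) r \<noteq> 0 \<longleftrightarrow> A r \<noteq> 0) \<longleftrightarrow> (\<forall>r. c r \<noteq> 0 \<longleftrightarrow> A r \<noteq> 0)"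
    using simple_transp_pos_iff[OF m(1)] by simp
  show ?case
  proof (cases "\<forall>r. c r \<noteq> 0 \<longleftrightarrow> A r \<noteq> 0")
    case False
    then show ?thesis
      unfolding col supp if_not_P[OF False] by (simp add: dem_pair_0)
  next
    case True
    have "dem_pair m (col_wt N c * G c) (if ?s \<circ> c = c then 0 else col_wt N (?s \<circ> c) * G (?s \<circ> c))"
      using Suc.prems m(1)
    proof (cases rule: low_first_cases)
      case none
      then have fixed: "?s \<circ> c = c" by (simp add: swap_vals_eq_iff)
      \<comment> \<open>A column without the two values is its own orbit and admits both
        arrangements of \<open>d\<close> or neither, so the pair is merged into its first
        component.\<close>
      have "dem_pair m ((if fits c d then Z d else 0) + (if fits c (?s \<circ> d) then g d else 0)) 0"
        if "d \<in> ?D" for d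
        unfolding fits_no_val[OF m(1) none] using dem_pair_merge[OF dem[OF that]] dem_pair_0 by simp
      then have "dem_pair m (G c) (\<Sum>d\<in>?D. 0)"
        unfolding G by (rule dem_pair_sum)
      then have "dem_pair m (G c) 0" by simp
      moreover have "swap_vars m (col_wt N c) = col_wt N c"
        unfolding col_wt_def using none m(1) by (intro swap_vars_partial_wt) auto
      ultimately show ?thesis
        unfolding if_P[OF fixed] using dem_pair_mult[of m "col_wt N c" "G c" 0] by simp
    next
      case (single p)
      have ne: "?s \<circ> c \<noteq> c" using single(1) by (auto simp: swap_vals_eq_iff is_val_def)
      \<comment> \<open>The weight of the rows without \<open>m\<close> or \<open>Suc m\<close> is
        symmetric and the same for both arrangements.\<close>
      define u where "u = (\<Prod>r\<in>{1..N} - {p}. entry_var (c r))"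
      have p: "p \<in> {1..N}" using columns_in_range[OF Suc.prems(1)] single(1) m(1) by simp
      have rest: "\<not> is_val m (c r)" if "r \<in> {1..N} - {p}" for r
        using single(2)[of r] that by auto
      have wt: "col_wt N c = var m * u"
        unfolding col_wt_def prod.remove[OF finite_atLeastAtMost p] u_def
        using single(1) m(1) by simp
      have rest_eq: "(\<Prod>r\<in>{1..N} - {p}. entry_var ((?s \<circ> c) r)) = u"
        unfolding u_def by (rule partial_wt_swap_vals) (rule rest)
      have wt': "col_wt N (?s \<circ> c) = var (Suc m) * u"
        unfolding col_wt_def prod.remove[OF finite_atLeastAtMost p] rest_eq
        using single(1) m(1) by (simp add: simple_transp_apply)
      have u: "swap_vars m u = u"
        unfolding u_def by (rule swap_vars_partial_wt[OF m(1) rest])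
      have "dem_pair m (var m * ((if fits c d then Z d else 0) + (if fits c (?s \<circ> d) then g d else 0)))
          (var (Suc m) * ((if fits (?s \<circ> c) d then Z d else 0) + (if fits (?s \<circ> c) (?s \<circ> d) then g d else 0)))"
        if "d \<in> ?D" for d
        by (rule dem_pair_single_step[OF dem[OF that]], rule fits_single[where c = c, OF m(1)])
          (use that single in auto)
      then have "dem_pair m (var m * G c) (var (Suc m) * G (?s \<circ> c))"
        unfolding G sum_distrib_left by (rule dem_pair_sum)
      from dem_pair_mult[OF u this] show ?thesis
        unfolding if_not_P[OF ne] wt wt' by (simp only: ac_simps)
    next
      case (double p q)
      have ne: "?s \<circ> c \<noteq> c" using double(2) by (auto simp: swap_vals_eq_iff is_val_def)
      define u where "u = (\<Prod>r\<in>{1..N} - {p} - {q}. entry_var (c r))"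
      have p: "p \<in> {1..N}" using columns_in_range[OF Suc.prems(1)] double(2) m(1) by simp
      have q: "q \<in> {1..N} - {p}" using columns_in_range[OF Suc.prems(1)] double(1,3) by simp
      have fin: "finite ({1..N} - {p})" by simp
      have rest: "\<not> is_val m (c r)" if "r \<in> {1..N} - {p} - {q}" for r
        using double(4)[of r] that by auto
      have wt: "col_wt N c = var m * (var (Suc m) * u)"
        unfolding col_wt_def prod.remove[OF finite_atLeastAtMost p] prod.remove[OF fin q] u_def
        using double(2,3) m(1) by simp
      have rest_eq: "(\<Prod>r\<in>{1..N} - {p} - {q}. entry_var ((?s \<circ> c) r)) = u"
        unfolding u_def by (rule partial_wt_swap_vals) (rule rest)
      have wt': "col_wt N (?s \<circ> c) = var m * (var (Suc m) * u)"
        unfolding col_wt_def prod.remove[OF finite_atLeastAtMost p] prod.remove[OF fin q] rest_eq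
        using double(2,3) m(1) by (simp add: simple_transp_apply)
      have "swap_vars m u = u"
        unfolding u_def by (rule swap_vars_partial_wt[OF m(1) rest])
      then have u: "swap_vars m (var m * (var (Suc m) * u)) = var m * (var (Suc m) * u)"
        unfolding swap_vars_mult swap_vars_var_apply by (simp only: ac_simps)
      have "dem_pair m ((if fits c d then Z d else 0) + (if fits c (?s \<circ> d) then g d else 0))
          ((if fits (?s \<circ> c) d then Z d else 0) + (if fits (?s \<circ> c) (?s \<circ> d) then g d else 0))"
        if "d \<in> ?D" for d
        by (rule dem_pair_double_step[OF dem[OF that]], rule fits_double[where c = c and N = N, OF m(1)])
          (use that double in auto)
      then have "dem_pair m (G c) (G (?s \<circ> c))"
        unfolding G by (rule dem_pair_sum)
      from dem_pair_mult[OF u this] show ?thesis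
        unfolding if_not_P[OF ne] wt wt' .
    qed
    then show ?thesis
      unfolding col supp if_P[OF True] .
  qed
qed

text \<open>Grouping first columns into orbits shows the right-hand side to be symmetric. The
  columns that the flag \<open>id\<close> excludes have \<open>Suc m\<close> in row \<open>m\<close>
  and are second members of their orbits, so the difference of the two generating functions is a sum
  of second components.\<close>

lemma pi_op_flagged_key_poly:
  assumes wc: "weak_composition \<alpha>" and m: "1 \<le> m"
  shows "pi_op m (flagged_key_poly \<alpha> id) = flagged_key_poly \<alpha> (id(m := Suc m))"
proof -
  let ?s = "simple_transp m"
  let ?\<phi> = "id(m := Suc m)"
  let ?K = "Poly_Mapping.keys \<alpha>"
  obtain n where n: "\<And>r. Poly_Mapping.lookup \<alpha> r \<le> n" using bounded_comp by blast
  define N where "N = Max (insert (Suc m) ?K)"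
  have N: "x \<le> N" if "x \<in> insert (Suc m) ?K" for x
    unfolding N_def by (rule Max_ge) (use that in auto)
  have mN: "Suc m \<le> N" using N by simp
  define Z where "Z = col_sum N n (Poly_Mapping.lookup \<alpha>)"
  define B where "B c = (if ?s \<circ> c = c then 0 else Z (?s \<circ> c))" for c
  let ?C = "{c \<in> columns N. \<forall>r. c r \<le> ?\<phi> r}"
  let ?D = "{c \<in> ?C. low_first m c}"
  \<comment> \<open>The first members of those orbits whose second member has \<open>Suc m\<close>
    in row \<open>m\<close>.\<close>
  let ?R = "{c \<in> ?D. c m = m}"
  have F: "flagged_key_poly \<alpha> id = (\<Sum>c\<in>{c \<in> columns N. \<forall>r. c r \<le> id r}. Z c)"
    unfolding Z_def by (rule flagged_key_poly_eq_col_sum[OF wc n]) (use N in auto)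
  have G: "flagged_key_poly \<alpha> ?\<phi> = (\<Sum>c\<in>?C. Z c)"
    unfolding Z_def by (rule flagged_key_poly_eq_col_sum[OF wc n]) (use N in auto)
  have dem: "dem_pair m (Z c) (B c)" if "c \<in> ?D" for c
    unfolding Z_def B_def by (rule col_sum_dem_pair[OF m mN]) (use that in auto)
  \<comment> \<open>Rows before \<open>m\<close> have entries less than \<open>m\<close>, and all
    other rows admit both \<open>m\<close> and \<open>Suc m\<close>.\<close>
  have inv: "?s \<circ> c \<in> ?C" if "c \<in> ?C" for c
  proof -
    have "?s (c r) \<le> ?\<phi> r" for r
    proof -
      have "c r \<le> ?\<phi> r" using that by blast
      then show ?thesis
        by (cases r m rule: linorder_cases) (auto simp: simple_transp_def transpose_def)
    qed
    then show ?thesis using columns_swap_vals[OF m mN] that by simp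
  qed
  have "(\<Sum>c\<in>?C. Z c) = (\<Sum>c\<in>?D. Z c + B c)"
    unfolding B_def
  proof (rule sum_involution)
    show "finite ?C" by simp
    show "?s \<circ> (?s \<circ> c) = c" for c by (rule swap_vals_involutory)
  qed (use inv low_first_swap_vals m low_first_of_fixed in blast)+
  then have sym: "swap_vars m (\<Sum>c\<in>?C. Z c) = (\<Sum>c\<in>?C. Z c)"
    using dem by (simp add: swap_vars_sum dem_pair_def)
  have split: "(\<Sum>c\<in>?C. Z c) = (\<Sum>c\<in>{c \<in> columns N. \<forall>r. c r \<le> id r}. Z c) + (\<Sum>c\<in>?R. B c)"
  proof -
    let ?S = "{c \<in> ?C. c m = Suc m}"
    have "?C = {c \<in> columns N. \<forall>r. c r \<le> id r} \<union> ?S"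
    proof (intro equalityI subsetI)
      fix c assume c: "c \<in> ?C"
      have "c r \<le> id r" if "c m \<noteq> Suc m" for r
      proof -
        have "c r \<le> ?\<phi> r" using c by blast
        then show ?thesis using that by (cases "r = m") auto
      qed
      then show "c \<in> {c \<in> columns N. \<forall>r. c r \<le> id r} \<union> ?S" using c by blast
    next
      fix c assume "c \<in> {c \<in> columns N. \<forall>r. c r \<le> id r} \<union> ?S"
      moreover have "c r \<le> ?\<phi> r" if "c r \<le> id r" for r
        using that by (cases "r = m") auto
      ultimately show "c \<in> ?C" by blast
    qed
    then have "(\<Sum>c\<in>?C. Z c) = (\<Sum>c\<in>{c \<in> columns N. \<forall>r. c r \<le> id r} \<union> ?S. Z c)"
      by (rule arg_cong)
    also have "\<dots> = (\<Sum>c\<in>{c \<in> columns N. \<forall>r. c r \<le> id r}. Z c) + (\<Sum>c\<in>?S. Z c)"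
    proof (rule sum.union_disjoint)
      have "\<not> (\<forall>r. c r \<le> id r)" if "c m = Suc m" for c
        using that by (auto intro!: exI[of _ m])
      then show "{c \<in> columns N. \<forall>r. c r \<le> id r} \<inter> ?S = {}" by blast
    qed auto
    also have "(\<Sum>c\<in>?S. Z c) = (\<Sum>c\<in>?R. B c)"
    proof (rule sum.reindex_bij_witness[of _ "\<lambda>c. ?s \<circ> c" "\<lambda>c. ?s \<circ> c"])
      fix c assume c: "c \<in> ?S"
      have ne: "?s \<circ> c \<noteq> c"
        using c by (auto simp: swap_vals_eq_iff is_val_def)
      \<comment> \<open>The flag keeps an entry \<open>m\<close> out of the rows before
        \<open>m\<close>.\<close>
      have "\<not> low_first m c"
      proof
        assume "low_first m c"
        then obtain s where s: "s < m" "c s = m" using c unfolding low_first_def by blast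
        have "c s \<le> ?\<phi> s" using c by blast
        then show False using s by simp
      qed
      then have "low_first m (?s \<circ> c)"
        using low_first_swap_vals[of c N m] c m ne by blast
      then show "?s \<circ> c \<in> ?R"
        using inv[of c] c by simp
      show "B (?s \<circ> c) = Z c"
        unfolding B_def swap_vals_involutory using ne by auto
    next
      fix c assume c: "c \<in> ?R"
      then show "?s \<circ> c \<in> ?S" using inv[of c] by (simp add: simple_transp_apply)
    qed (rule swap_vals_involutory)+
    finally show ?thesis .
  qed
  have "dem_pair m (\<Sum>c\<in>?R. Z c) (\<Sum>c\<in>?R. B c)"
    by (rule dem_pair_sum) (use dem in auto)
  then obtain h where h: "swap_vars m h = h" "(\<Sum>c\<in>?R. B c) = var (Suc m) * h"
    unfolding dem_pair_def by blast
  define f where "f = flagged_key_poly \<alpha> id"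
  define g where "g = flagged_key_poly \<alpha> ?\<phi>"
  have g: "g = f + var (Suc m) * h" "swap_vars m g = g"
    unfolding f_def g_def F G h(2)[symmetric] by (rule split, rule sym)
  have sf: "swap_vars m f = g - var m * h"
  proof -
    have "g = swap_vars m f + var m * h"
      using g(2) by (subst (asm) g(1)) (simp add: swap_vars_add swap_vars_mult swap_vars_var_apply h(1))
    then show ?thesis by simp
  qed
  have "pi_op m f = g"
  proof (rule pi_op_eqI)
    show "(var m - var (m + 1)) * g = var m * f - var (m + 1) * swap_vars m f"
      unfolding sf unfolding g(1) by (simp add: algebra_simps)
  qed
  then show ?thesis by (simp add: f_def g_def)
qed

subsection \<open>Key polynomials\<close>

text \<open>In a partition, a column with a box in row \<open>r\<close> has boxes in all earlier
  rows. By induction these hold the values less than \<open>r\<close>, and the entry of row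
  \<open>r\<close> is at most \<open>r\<close>, so it equals \<open>r\<close>.\<close>

lemma flagged_key_poly_partition:
  assumes "is_partition \<mu>"
  shows "flagged_key_poly \<mu> id = monomial \<mu>"
proof -
  let ?T = "\<lambda>b\<in>boxes \<mu>. fst b"
  have lower: "(s, c) \<in> boxes \<mu>" if "(r, c) \<in> boxes \<mu>" "1 \<le> s" "s \<le> r" for r s c
  proof -
    have "Poly_Mapping.lookup \<mu> r \<le> Poly_Mapping.lookup \<mu> s"
      using assms that by (simp add: is_partition_def)
    then show ?thesis using that by (simp add: boxes_def)
  qed
  have "?T \<in> SSKT \<mu> id"
    by (auto simp: SSKT_def key_tableau_def flagged_def tableaux_def boxes_def)
  moreover have "T = ?T" if "T \<in> SSKT \<mu> id" for T
  proof -
    have T: "T \<in> boxes \<mu> \<rightarrow>\<^sub>E {1..}" and le: "\<And>r c. (r, c) \<in> boxes \<mu> \<Longrightarrow> T (r, c) \<le> r"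
      and inj: "\<And>r s c. (r, c) \<in> boxes \<mu> \<Longrightarrow> (s, c) \<in> boxes \<mu> \<Longrightarrow> r \<noteq> s \<Longrightarrow> T (r, c) \<noteq> T (s, c)"
      using that unfolding SSKT_def key_tableau_def tableaux_def flagged_def by auto
    have eq: "T (r, c) = r" if "(r, c) \<in> boxes \<mu>" for r c
      using that
    proof (induction r rule: less_induct)
      case (less r)
      show ?case
      proof (rule ccontr)
        assume ne: "T (r, c) \<noteq> r"
        define s where "s = T (r, c)"
        have s: "1 \<le> s" "s < r" using T less.prems le[OF less.prems] ne by (auto simp: s_def PiE_iff)
        have "(s, c) \<in> boxes \<mu>" using lower[OF less.prems] s by simp
        then have "T (s, c) = s" using less.IH s by blast
        then show False using inj[OF less.prems \<open>(s, c) \<in> boxes \<mu>\<close>] s by (simp add: s_def)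
      qed
    qed
    show "T = ?T"
    proof
      fix b show "T b = ?T b"
        using T eq by (cases b; cases "b \<in> boxes \<mu>") (auto simp: PiE_iff extensional_def)
    qed
  qed
  ultimately have "SSKT \<mu> id = {?T}" by blast
  moreover have "tab_wt \<mu> ?T = \<mu>"
  proof (rule poly_mapping_eqI)
    fix i
    have "{b \<in> boxes \<mu>. ?T b = i} = {i} \<times> (if i = 0 then {} else {1..Poly_Mapping.lookup \<mu> i})"
      by (auto simp: boxes_def)
    moreover have "Poly_Mapping.lookup \<mu> 0 = 0"
      using assms by (simp add: is_partition_def weak_composition_def)
    ultimately show "Poly_Mapping.lookup (tab_wt \<mu> ?T) i = Poly_Mapping.lookup \<mu> i"
      unfolding lookup_tab_wt by (simp add: card_cartesian_product)
  qed
  ultimately show ?thesis by (simp add: flagged_key_poly_def)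
qed

text \<open>\<open>pi_op m\<close> raises the flag of row \<open>m\<close> to that of the next row.
  Then the two rows may be exchanged, and with the shorter one in row \<open>m\<close> the flag can
  be lowered back to \<open>id\<close>.\<close>

lemma pi_op_flagged_key_poly_ascent:
  assumes wc: "weak_composition \<alpha>" and m: "1 \<le> m"
    and less: "Poly_Mapping.lookup \<alpha> m < Poly_Mapping.lookup \<alpha> (Suc m)"
  shows "pi_op m (flagged_key_poly (comp_act \<alpha> (simple_transp m)) id) = flagged_key_poly \<alpha> id"
proof -
  let ?\<beta> = "comp_act \<alpha> (simple_transp m)"
  let ?\<phi> = "id(m := Suc m)"
  have wc': "weak_composition ?\<beta>" using wc m by simp
  have "pi_op m (flagged_key_poly ?\<beta> id) = flagged_key_poly ?\<beta> ?\<phi>"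
    by (rule pi_op_flagged_key_poly[OF wc' m])
  also have "\<dots> = flagged_key_poly (comp_act ?\<beta> (simple_transp m)) ?\<phi>"
    by (rule flagged_key_poly_swap_rows[OF wc' m])
      (use less in \<open>simp_all add: lookup_act_simple_transp simple_transp_apply\<close>)
  also have "\<dots> = flagged_key_poly \<alpha> ?\<phi>" by simp
  also have "\<dots> = flagged_key_poly \<alpha> (flag_minus_e ?\<phi> m)"
    by (rule flagged_key_poly_decrease_flag[OF wc m]) (use less in auto)
  also have "flag_minus_e ?\<phi> m = id" by (auto simp: flag_minus_e_def)
  finally show ?thesis .
qed

section \<open>Ascents of a composition\<close>

text \<open>The pairs of positions that are out of order with respect to a partition; their number
  turns out to be the least length of a sorting word.\<close>

definition ascents :: "comp \<Rightarrow> (nat \<times> nat) set" where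
  "ascents \<alpha> = {(p, q). 1 \<le> p \<and> p < q \<and> Poly_Mapping.lookup \<alpha> p < Poly_Mapping.lookup \<alpha> q}"

lemma finite_ascents [simp]: "finite (ascents \<alpha>)"
proof (rule finite_subset)
  show "ascents \<alpha> \<subseteq> (\<lambda>(q, p). (p, q)) ` (SIGMA q:Poly_Mapping.keys \<alpha>. {..<q})"
    by (auto simp: ascents_def in_keys_iff image_iff)
qed auto

lemma simple_transp_ge_1 [simp]: "1 \<le> m \<Longrightarrow> 1 \<le> simple_transp m r \<longleftrightarrow> 1 \<le> r"
  using simple_transp_pos_iff[of m r] by (simp add: Suc_le_eq)

lemma ascents_swap_subset:
  assumes "1 \<le> m" "(p, q) \<in> ascents \<alpha>" "(p, q) \<noteq> (m, Suc m)"
  shows "(simple_transp m p, simple_transp m q) \<in> ascents (comp_act \<alpha> (simple_transp m))"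
proof -
  have "1 \<le> p" "p < q" "Poly_Mapping.lookup \<alpha> p < Poly_Mapping.lookup \<alpha> q"
    using assms(2) by (simp_all add: ascents_def)
  moreover have "simple_transp m p < simple_transp m q"
    by (rule simple_transp_less) (use calculation assms(3) in auto)
  ultimately show ?thesis
    using simple_transp_ge_1[OF assms(1)] by (simp add: ascents_def lookup_act_simple_transp)
qed

text \<open>Transposing both positions is a bijection between the ascents before and after, apart
  from \<open>(m, Suc m)\<close>, which is an ascent only before.\<close>

lemma card_ascents_swap:
  assumes m: "1 \<le> m" and less: "Poly_Mapping.lookup \<alpha> m < Poly_Mapping.lookup \<alpha> (Suc m)"
  shows "card (ascents \<alpha>) = Suc (card (ascents (comp_act \<alpha> (simple_transp m))))"
proof -
  let ?s = "simple_transp m"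
  let ?\<beta> = "comp_act \<alpha> ?s"
  let ?f = "\<lambda>(p, q). (?s p, ?s q)"
  have in_\<beta>: "(m, Suc m) \<notin> ascents ?\<beta>"
    using less by (simp add: ascents_def lookup_act_simple_transp simple_transp_apply)
  have "bij_betw ?f (ascents ?\<beta>) (ascents \<alpha> - {(m, Suc m)})"
  proof (rule bij_betw_byWitness[where f' = ?f])
    show "?f ` ascents ?\<beta> \<subseteq> ascents \<alpha> - {(m, Suc m)}"
    proof (clarify, intro conjI DiffI)
      fix p q assume pq: "(p, q) \<in> ascents ?\<beta>"
      then have "(p, q) \<noteq> (m, Suc m)" using in_\<beta> by auto
      then show "(?s p, ?s q) \<in> ascents \<alpha>"
        using ascents_swap_subset[OF m pq] by simp
      have "p < q" using pq by (simp add: ascents_def)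
      then show "(?s p, ?s q) \<notin> {(m, Suc m)}" by auto
    qed
    show "?f ` (ascents \<alpha> - {(m, Suc m)}) \<subseteq> ascents ?\<beta>"
      using ascents_swap_subset[OF m] by auto
  qed auto
  then have "card (ascents ?\<beta>) = card (ascents \<alpha> - {(m, Suc m)})"
    by (rule bij_betw_same_card)
  moreover have "(m, Suc m) \<in> ascents \<alpha>" using m less by (simp add: ascents_def)
  ultimately show ?thesis using card_Suc_Diff1[OF finite_ascents, of "(m, Suc m)" \<alpha>] by argo
qed

lemma partition_or_ascent:
  assumes "weak_composition \<alpha>"
  obtains "is_partition \<alpha>"
  | m where "1 \<le> m" "Poly_Mapping.lookup \<alpha> m < Poly_Mapping.lookup \<alpha> (Suc m)"
proof (cases "\<exists>m\<ge>1. Poly_Mapping.lookup \<alpha> m < Poly_Mapping.lookup \<alpha> (Suc m)")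
  case False
  have "Poly_Mapping.lookup \<alpha> j \<le> Poly_Mapping.lookup \<alpha> i" if "1 \<le> i" "i \<le> j" for i j
    using that(2)
  proof (induction j rule: dec_induct)
    case (step j)
    have "Poly_Mapping.lookup \<alpha> (Suc j) \<le> Poly_Mapping.lookup \<alpha> j"
      using False step.hyps that(1) by (meson le_trans not_less)
    then show ?case using step.IH by simp
  qed simp
  then show ?thesis using that(1) assms by (simp add: is_partition_def)
qed (use that in blast)

section \<open>Words in simple transpositions and shortest sorting words\<close>

lemma perm_of_word_Nil [simp]: "perm_of_word [] = id"
  and perm_of_word_Cons [simp]: "perm_of_word (i # is) = simple_transp i \<circ> perm_of_word is"
  by (simp_all add: perm_of_word_def)

lemma perm_of_word_append: "perm_of_word (is @ js) = perm_of_word is \<circ> perm_of_word js"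
  by (induction "is") (simp_all add: comp_assoc)

lemma inj_perm_of_word [simp]: "inj (perm_of_word is)"
  by (induction "is") (auto intro: inj_compose simp del: o_apply)

lemma comp_act_perm_of_word_Cons:
  "comp_act \<alpha> (perm_of_word (i # is)) = comp_act (comp_act \<alpha> (simple_transp i)) (perm_of_word is)"
  unfolding perm_of_word_Cons by (rule comp_act_compose[symmetric]) simp_all

lemma comp_act_id [simp]: "comp_act \<alpha> id = \<alpha>"
  by (rule poly_mapping_eqI) (simp add: lookup_comp_act)

lemma perm_of_word_permutes:
  assumes "set is \<subseteq> {1..}"
  shows "\<exists>n. perm_of_word is permutes {1..n}"
  using assms
proof (induction "is")
  case (Cons i "is")
  then obtain n where n: "perm_of_word is permutes {1..n}" by auto
  let ?n = "max n (Suc i)"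
  have "perm_of_word is permutes {1..?n}" by (rule permutes_subset[OF n]) auto
  moreover have "simple_transp i permutes {1..?n}"
    by (rule simple_transp_permutes) (use Cons.prems in auto)
  ultimately have "perm_of_word (i # is) permutes {1..?n}"
    unfolding perm_of_word_Cons by (rule permutes_compose)
  then show ?case by blast
qed (auto simp: permutes_id)

lemma word_of_compose: "word_of u is \<Longrightarrow> word_of v js \<Longrightarrow> word_of (u \<circ> v) (is @ js)"
  by (auto simp: word_of_def perm_of_word_append)

lemma word_of_simple_transp: "1 \<le> a \<Longrightarrow> word_of (simple_transp a) [a]"
  by (simp add: word_of_def)

text \<open>Conjugating by the simple transposition at the upper end moves this end up by
  one.\<close>

lemma word_of_transpose_add:
  assumes "1 \<le> a"
  shows "\<exists>is. word_of (transpose a (a + Suc k)) is"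
proof (induction k)
  case 0
  show ?case using word_of_simple_transp[OF assms] by (auto simp: simple_transp_def)
next
  case (Suc k)
  let ?b = "a + Suc k"
  obtain "is" where "is": "word_of (transpose a ?b) is" using Suc.IH by blast
  have "transpose a (Suc ?b) = simple_transp ?b \<circ> (transpose a ?b \<circ> simple_transp ?b)"
    by (auto simp: fun_eq_iff simple_transp_def transpose_def)
  moreover have b: "word_of (simple_transp ?b) [?b]" by (rule word_of_simple_transp) simp
  ultimately have "word_of (transpose a (Suc ?b)) ([?b] @ (is @ [?b]))"
    using word_of_compose[OF b word_of_compose[OF "is" b]] by simp
  then show ?case by auto
qed

text \<open>Ensures that a reduced word of \<open>key_perm\<close> exists, of which it is only known
  that it permutes an initial segment and sorts the composition.\<close>

lemma ex_word_of_permutes: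
  assumes "w permutes {1..n}"
  shows "\<exists>is. word_of w is"
  using assms finite_atLeastAtMost
proof (induction rule: permutes_induct)
  case id
  have "word_of id []" by (simp add: word_of_def)
  then show ?case by blast
next
  case (swap a b p)
  have ex: "\<exists>is. word_of (transpose a b) is" if "1 \<le> a" "a < b" for a b :: nat
    using word_of_transpose_add[OF that(1), of "b - Suc a"] that(2) by simp
  have "\<exists>is. word_of (transpose a b) is"
  proof (cases "a < b")
    case True
    then show ?thesis using ex[of a b] swap.hyps by simp
  next
    case False
    then show ?thesis using ex[of b a] swap.hyps by (simp add: transpose_commute)
  qed
  then show ?case using swap.IH word_of_compose by blast
qed

lemma ascents_partition: "is_partition \<alpha> \<Longrightarrow> ascents \<alpha> = {}"
  unfolding is_partition_def ascents_def by clarsimp (meson leD less_imp_le)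

text \<open>Each letter removes at most one ascent, and a partition has none.\<close>

lemma card_ascents_le_length:
  assumes "set is \<subseteq> {1..}" "is_partition (comp_act \<alpha> (perm_of_word is))"
  shows "card (ascents \<alpha>) \<le> length is"
  using assms
proof (induction "is" arbitrary: \<alpha>)
  case Nil
  then have "is_partition \<alpha>" unfolding perm_of_word_Nil comp_act_id by blast
  then show ?case by (simp add: ascents_partition)
next
  case (Cons i "is")
  let ?\<beta> = "comp_act \<alpha> (simple_transp i)"
  have i: "1 \<le> i" using Cons.prems(1) by simp
  have part: "is_partition (comp_act ?\<beta> (perm_of_word is))"
    using Cons.prems(2) by (simp only: comp_act_perm_of_word_Cons)
  have "card (ascents ?\<beta>) \<le> length is"
    by (rule Cons.IH[OF _ part]) (use Cons.prems(1) in simp)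
  moreover have "card (ascents \<alpha>) \<le> Suc (card (ascents ?\<beta>))"
  proof (cases "Poly_Mapping.lookup \<alpha> i" "Poly_Mapping.lookup \<alpha> (Suc i)" rule: linorder_cases)
    case less
    then show ?thesis using card_ascents_swap[OF i] by simp
  next
    case equal
    then have "Poly_Mapping.lookup \<alpha> \<circ> simple_transp i = Poly_Mapping.lookup \<alpha>"
      by (simp add: swap_rows_eq_iff)
    then have "?\<beta> = \<alpha>"
      by (intro poly_mapping_eqI) (simp add: lookup_act_simple_transp fun_eq_iff)
    then show ?thesis by simp
  next
    case greater
    \<comment> \<open>A descent at \<open>i\<close> is an ascent of \<open>?\<beta>\<close>, so this
      letter creates an ascent instead of removing one.\<close>
    then show ?thesis
      using card_ascents_swap[OF i, of ?\<beta>] by (simp add: lookup_act_simple_transp simple_transp_apply)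
  qed
  ultimately show ?case by simp
qed

text \<open>Bubble sort: a composition that is not a partition has an ascent in adjacent positions,
  and exchanging them lowers the count by one.\<close>

lemma ex_sorting_word:
  assumes "weak_composition \<alpha>"
  shows "\<exists>is. set is \<subseteq> {1..} \<and> is_partition (comp_act \<alpha> (perm_of_word is)) \<and>
    length is = card (ascents \<alpha>)"
  using assms
proof (induction "card (ascents \<alpha>)" arbitrary: \<alpha> rule: less_induct)
  case less
  from less.prems show ?case
  proof (cases rule: partition_or_ascent)
    case 1
    then show ?thesis by (intro exI[of _ "[]"]) (simp add: ascents_partition)
  next
    case (2 m)
    note card = card_ascents_swap[OF 2]
    obtain "is" where "is": "set is \<subseteq> {1..}"
      "is_partition (comp_act (comp_act \<alpha> (simple_transp m)) (perm_of_word is))"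
      "length is = card (ascents (comp_act \<alpha> (simple_transp m)))"
      using less.hyps[of "comp_act \<alpha> (simple_transp m)"] card less.prems 2(1) by auto
    then show ?thesis
      using 2(1) card by (intro exI[of _ "m # is"]) (simp add: comp_act_perm_of_word_Cons del: perm_of_word_Cons)
  qed
qed

text \<open>A sorting word no longer than the number of ascents removes one with every letter, so
  each \<open>pi_op\<close> meets an adjacent ascent and
  \<open>pi_op_flagged_key_poly_ascent\<close> applies. The sorted composition contributes its
  monomial.\<close>

lemma foldr_pi_op_sorting_word:
  assumes "weak_composition \<alpha>" "set is \<subseteq> {1..}" "is_partition (comp_act \<alpha> (perm_of_word is))"
    "length is = card (ascents \<alpha>)"
  shows "foldr pi_op is (monomial (comp_act \<alpha> (perm_of_word is))) = flagged_key_poly \<alpha> id"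
  using assms
proof (induction "is" arbitrary: \<alpha>)
  case Nil
  then have "is_partition \<alpha>" unfolding perm_of_word_Nil comp_act_id by blast
  then show ?case
    by (metis comp_act_id flagged_key_poly_partition foldr_Nil id_apply perm_of_word_Nil)
next
  case (Cons i "is")
  let ?\<beta> = "comp_act \<alpha> (simple_transp i)"
  have i: "1 \<le> i" using Cons.prems(2) by simp
  have part: "is_partition (comp_act ?\<beta> (perm_of_word is))"
    using Cons.prems(3) by (simp only: comp_act_perm_of_word_Cons)
  have le: "card (ascents ?\<beta>) \<le> length is"
    by (rule card_ascents_le_length[OF _ part]) (use Cons.prems(2) in simp)
  \<comment> \<open>Otherwise the first letter would remove no ascent, and \<open>is\<close> would
    be too short to sort \<open>?\<beta>\<close>.\<close>
  have less: "Poly_Mapping.lookup \<alpha> i < Poly_Mapping.lookup \<alpha> (Suc i)"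
  proof (rule ccontr)
    assume "\<not> ?thesis"
    then consider "Poly_Mapping.lookup \<alpha> i = Poly_Mapping.lookup \<alpha> (Suc i)"
      | "Poly_Mapping.lookup \<alpha> (Suc i) < Poly_Mapping.lookup \<alpha> i" by linarith
    then have "card (ascents \<alpha>) \<le> card (ascents ?\<beta>)"
    proof cases
      case 1
      then have "Poly_Mapping.lookup \<alpha> \<circ> simple_transp i = Poly_Mapping.lookup \<alpha>"
        by (simp add: swap_rows_eq_iff)
      then have "?\<beta> = \<alpha>"
        by (intro poly_mapping_eqI) (simp add: lookup_act_simple_transp fun_eq_iff)
      then show ?thesis by simp
    next
      case 2
      then show ?thesis
        using card_ascents_swap[OF i, of ?\<beta>] by (simp add: lookup_act_simple_transp simple_transp_apply)
    qed
    then show False using le Cons.prems(4) by simp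
  qed
  have "length is = card (ascents ?\<beta>)"
    using card_ascents_swap[OF i less] Cons.prems(4) by simp
  then have "foldr pi_op is (monomial (comp_act ?\<beta> (perm_of_word is))) = flagged_key_poly ?\<beta> id"
    by (intro Cons.IH[OF _ _ part]) (use Cons.prems(1,2) i in simp_all)
  then show ?case
    unfolding comp_act_perm_of_word_Cons foldr_Cons comp_apply
    using pi_op_flagged_key_poly_ascent[OF Cons.prems(1) i less] by (simp only:)
qed

lemma ex_reduced_word:
  assumes "word_of w is"
  shows "\<exists>js. reduced_word w js" and "perm_length w \<le> length is"
proof -
  have "\<exists>js. word_of w js \<and> length js = perm_length w"
    unfolding perm_length_def by (rule LeastI_ex) (use assms in blast)
  then show "\<exists>js. reduced_word w js" by (simp add: reduced_word_def)
  show "perm_length w \<le> length is"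
    unfolding perm_length_def by (rule Least_le) (use assms in blast)
qed

text \<open>The permutation and its reduced word are arbitrary choices. Comparison with the word of
  \<open>ex_sorting_word\<close> bounds the length of the chosen word by the number of ascents,
  \<open>card_ascents_le_length\<close> gives the reverse bound, and
  \<open>foldr_pi_op_sorting_word\<close> covers every such word.\<close>

lemma key_poly_eq_flagged_key_poly:
  assumes wc: "weak_composition \<alpha>"
  shows "key_poly \<alpha> = flagged_key_poly \<alpha> id"
proof -
  let ?P = "\<lambda>w. (\<exists>n. w permutes {1..n}) \<and> is_partition (comp_act \<alpha> w)"
  obtain "is" where "is": "set is \<subseteq> {1..}" "is_partition (comp_act \<alpha> (perm_of_word is))"
    "length is = card (ascents \<alpha>)"
    using ex_sorting_word[OF wc] by blast
  have "?P (perm_of_word is)" using perm_of_word_permutes[OF "is"(1)] "is"(2) by blast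
  from arg_min_nat_lemma[where P = ?P and m = perm_length, OF this]
  have key: "?P (key_perm \<alpha>)" "perm_length (key_perm \<alpha>) \<le> perm_length (perm_of_word is)"
    unfolding key_perm_def using \<open>?P (perm_of_word is)\<close> by auto
  define js where "js = (SOME js. reduced_word (key_perm \<alpha>) js)"
  obtain ks where "word_of (key_perm \<alpha>) ks" using ex_word_of_permutes key(1) by blast
  then have "reduced_word (key_perm \<alpha>) js"
    unfolding js_def by (rule someI_ex[OF ex_reduced_word(1)])
  then have js: "set js \<subseteq> {1..}" "perm_of_word js = key_perm \<alpha>" "length js = perm_length (key_perm \<alpha>)"
    by (auto simp: reduced_word_def word_of_def)
  have "perm_length (perm_of_word is) \<le> length is"
    by (rule ex_reduced_word(2)) (use "is" in \<open>simp add: word_of_def\<close>)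
  then have "length js \<le> card (ascents \<alpha>)" using js(3) key(2) "is"(3) by simp
  moreover have part: "is_partition (comp_act \<alpha> (perm_of_word js))" using key(1) js(2) by simp
  moreover have "card (ascents \<alpha>) \<le> length js" by (rule card_ascents_le_length[OF js(1) part])
  ultimately have "foldr pi_op js (monomial (comp_act \<alpha> (perm_of_word js))) = flagged_key_poly \<alpha> id"
    by (intro foldr_pi_op_sorting_word[OF wc js(1)]) auto
  then show ?thesis
    by (simp add: key_poly_def pi_perm_def js(2) flip: js_def)
qed

section \<open>Relabelling rows for strictly increasing flags\<close>

text \<open>The key conditions compare rows only by their order, so an order preserving relabelling
  transports them. In the second premise \<open>c'\<close> varies because (c) asks for a box in the
  next column: corresponding rows must have equal lengths.\<close>

lemma SSKT_relabel_rows: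
  assumes T: "T \<in> SSKT \<delta> \<psi>"
    and box: "\<And>r c c'. (r, c) \<in> boxes \<gamma> \<Longrightarrow> (h r, c') \<in> boxes \<delta> \<longleftrightarrow> (r, c') \<in> boxes \<gamma>"
    and mono: "\<And>r s c. (r, c) \<in> boxes \<gamma> \<Longrightarrow> (s, c) \<in> boxes \<gamma> \<Longrightarrow> r < s \<Longrightarrow> h r < h s"
    and flag: "\<And>r c. (r, c) \<in> boxes \<gamma> \<Longrightarrow> \<psi> (h r) \<le> \<phi> r"
  shows "(\<lambda>b\<in>boxes \<gamma>. T (h (fst b), snd b)) \<in> SSKT \<gamma> \<phi>"
proof -
  have key: "key_tableau \<delta> T" and fl: "flagged \<delta> \<psi> T" using T by (simp_all add: SSKT_def)
  have tab: "T \<in> boxes \<delta> \<rightarrow>\<^sub>E {1..}" using key by (simp add: key_tableau_def tableaux_def)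
  let ?T = "\<lambda>b\<in>boxes \<gamma>. T (h (fst b), snd b)"
  have ne: "h r \<noteq> h s" if "(r, c) \<in> boxes \<gamma>" "(s, c) \<in> boxes \<gamma>" "r \<noteq> s" for r s c
    using mono[OF that(1,2)] mono[OF that(2,1)] that(3) by (cases r s rule: linorder_cases) auto
  show ?thesis
    unfolding SSKT_def key_tableau_def flagged_def mem_Collect_eq
  proof (intro conjI allI impI)
    show "?T \<in> tableaux \<gamma>"
      unfolding tableaux_def
    proof (intro PiE_I)
      fix b assume b: "b \<in> boxes \<gamma>"
      then have "(h (fst b), snd b) \<in> boxes \<delta>" using box[of "fst b" "snd b" "snd b"] by simp
      then show "?T b \<in> {1..}" using b tab by (auto simp: PiE_iff)
    qed auto
    fix i j assume ij: "(i, j) \<in> boxes \<gamma>"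
    have hij: "(h i, j) \<in> boxes \<delta>" using box ij by blast
    show "?T (i, j) \<le> \<phi> i"
    proof -
      have "T (h i, j) \<le> \<psi> (h i)" using fl hij unfolding flagged_def by blast
      also have "\<dots> \<le> \<phi> i" by (rule flag[OF ij])
      finally show ?thesis using ij by simp
    qed
    show "?T (i, j + 1) \<le> ?T (i, j)" if ij1: "(i, j + 1) \<in> boxes \<gamma>"
    proof -
      have "(h i, j + 1) \<in> boxes \<delta>" using box ij1 by blast
      then have "T (h i, j + 1) \<le> T (h i, j)" using key hij unfolding key_tableau_def by blast
      then show ?thesis using ij ij1 by simp
    qed
    fix k assume kj: "(k, j) \<in> boxes \<gamma>"
    have hkj: "(h k, j) \<in> boxes \<delta>" using box kj by blast
    show "?T (i, j) \<noteq> ?T (k, j)" if "i \<noteq> k"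
    proof -
      have "T (h i, j) \<noteq> T (h k, j)"
        using key hij hkj ne[OF ij kj that] unfolding key_tableau_def by blast
      then show ?thesis using ij kj by simp
    qed
    assume ik: "i < k" and less: "?T (k, j) < ?T (i, j)"
    have "T (h k, j) < T (h i, j)" using less ij kj by simp
    then have *: "(h i, j + 1) \<in> boxes \<delta> \<and> T (h k, j) < T (h i, j + 1)"
      using key hij hkj mono[OF ij kj ik] unfolding key_tableau_def by blast
    then show 1: "(i, j + 1) \<in> boxes \<gamma>" using box[OF ij] by blast
    show "?T (k, j) < ?T (i, j + 1)" using * 1 kj by simp
  qed
qed

text \<open>Moving row \<open>r\<close> to row \<open>\<phi> r\<close> keeps the order of the rows
  and turns the bound \<open>\<phi> r\<close> into the row number itself; \<open>g\<close> moves
  rows back. Rows outside the image of \<open>\<phi>\<close> are empty.\<close>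

lemma flagged_key_poly_strict:
  assumes wc: "weak_composition \<alpha>" and "flag \<phi>" and strict: "strict_mono_on {1..} \<phi>"
  shows "flagged_key_poly \<alpha> \<phi> = flagged_key_poly (flag_comp \<alpha> \<phi>) id"
proof -
  let ?\<beta> = "flag_comp \<alpha> \<phi>"
  define g where "g = inv_into {1..} \<phi>"
  have inj: "inj_on \<phi> {1..}" by (rule strict_mono_on_imp_inj_on[OF strict])
  have g\<phi>: "g (\<phi> r) = r" if "1 \<le> r" for r
    unfolding g_def using inv_into_f_f[OF inj, of r] that by simp
  have row1: "1 \<le> r" if "(r, c) \<in> boxes \<gamma>" for r c \<gamma>
    using that by (simp add: boxes_def)
  have less: "\<phi> r < \<phi> s" if "1 \<le> r" "r < s" for r s
    using strict that by (simp add: strict_mono_on_def)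
  have box\<phi>: "(\<phi> r, c) \<in> boxes ?\<beta> \<longleftrightarrow> (r, c) \<in> boxes \<alpha>" if "1 \<le> r" for r c
  proof -
    have "r \<le> \<phi> r" using assms(2) that by (simp add: flag_def)
    then show ?thesis using that by (simp add: boxes_def lookup_flag_comp(1)[OF strict that])
  qed
  have row: "1 \<le> g s \<and> \<phi> (g s) = s" if "(s, c) \<in> boxes ?\<beta>" for s c
  proof -
    have "Poly_Mapping.lookup ?\<beta> s \<noteq> 0" using that by (simp add: boxes_def)
    then have "\<exists>r. r \<ge> 1 \<and> \<phi> r = s"
      by (rule contrapos_np) (rule lookup_flag_comp(2)[OF strict])
    then obtain r where "1 \<le> r" "\<phi> r = s" by blast
    then show ?thesis using g\<phi> by auto
  qed
  show ?thesis
    unfolding flagged_key_poly_def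
  proof (rule sum.reindex_bij_witness[where
        i = "\<lambda>T. \<lambda>b\<in>boxes \<alpha>. T (\<phi> (fst b), snd b)" and
        j = "\<lambda>T. \<lambda>b\<in>boxes ?\<beta>. T (g (fst b), snd b)"])
    fix T assume T: "T \<in> SSKT \<alpha> \<phi>"
    let ?T = "\<lambda>b\<in>boxes ?\<beta>. T (g (fst b), snd b)"
    have ext: "T \<in> extensional (boxes \<alpha>)"
      using T by (simp add: SSKT_def key_tableau_def tableaux_def PiE_def)
    show "?T \<in> SSKT ?\<beta> id"
    proof (rule SSKT_relabel_rows[OF T])
      fix r c c' assume rc: "(r, c) \<in> boxes ?\<beta>"
      show "(g r, c') \<in> boxes \<alpha> \<longleftrightarrow> (r, c') \<in> boxes ?\<beta>"
        using box\<phi>[of "g r" c'] row[OF rc] by simp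
      show "\<phi> (g r) \<le> id r" using row[OF rc] by simp
    next
      fix r s c assume rs: "(r, c) \<in> boxes ?\<beta>" "(s, c) \<in> boxes ?\<beta>" "r < s"
      show "g r < g s"
        using row[OF rs(1)] row[OF rs(2)] rs(3) less[of "g s" "g r"]
        by (cases "g r" "g s" rule: linorder_cases) auto
    qed
    show "(\<lambda>b\<in>boxes \<alpha>. ?T (\<phi> (fst b), snd b)) = T"
    proof
      fix b
      show "(\<lambda>b\<in>boxes \<alpha>. ?T (\<phi> (fst b), snd b)) b = T b"
      proof (cases "b \<in> boxes \<alpha>")
        case True
        then have r: "1 \<le> fst b" using row1[of "fst b" "snd b" \<alpha>] by simp
        then have "(\<phi> (fst b), snd b) \<in> boxes ?\<beta>" using box\<phi>[OF r] True by simp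
        then show ?thesis using True g\<phi>[OF r] by simp
      qed (simp add: extensional_arb[OF ext])
    qed
    have "(\<Prod>b\<in>boxes ?\<beta>. var (?T b)) = (\<Prod>b\<in>boxes \<alpha>. var (T b))"
    proof (rule prod.reindex_bij_witness[where i = "\<lambda>b. (\<phi> (fst b), snd b)" and j = "\<lambda>b. (g (fst b), snd b)"])
      fix b assume b: "b \<in> boxes ?\<beta>"
      then have r: "1 \<le> g (fst b) \<and> \<phi> (g (fst b)) = fst b" using row[of "fst b" "snd b"] by simp
      then show "(\<phi> (fst (g (fst b), snd b)), snd (g (fst b), snd b)) = b" by simp
      show "(g (fst b), snd b) \<in> boxes \<alpha>" using box\<phi>[of "g (fst b)" "snd b"] r b by simp
      show "var (T (g (fst b), snd b)) = var (?T b)" using b by simp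
    next
      fix b assume b: "b \<in> boxes \<alpha>"
      then have r: "1 \<le> fst b" using row1[of "fst b" "snd b"] by simp
      show "(g (fst (\<phi> (fst b), snd b)), snd (\<phi> (fst b), snd b)) = b" using g\<phi>[OF r] by simp
      show "(\<phi> (fst b), snd b) \<in> boxes ?\<beta>" using box\<phi>[OF r] b by simp
    qed
    then show "monomial (tab_wt ?\<beta> ?T) = monomial (tab_wt \<alpha> T)"
      unfolding monomial_tab_wt .
  next
    fix T assume T: "T \<in> SSKT ?\<beta> id"
    let ?T = "\<lambda>b\<in>boxes \<alpha>. T (\<phi> (fst b), snd b)"
    have ext: "T \<in> extensional (boxes ?\<beta>)"
      using T by (simp add: SSKT_def key_tableau_def tableaux_def PiE_def)
    show "?T \<in> SSKT \<alpha> \<phi>"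
      by (rule SSKT_relabel_rows[OF T]) (use box\<phi> row1 less in auto)
    show "(\<lambda>b\<in>boxes ?\<beta>. ?T (g (fst b), snd b)) = T"
    proof
      fix b
      show "(\<lambda>b\<in>boxes ?\<beta>. ?T (g (fst b), snd b)) b = T b"
      proof (cases "b \<in> boxes ?\<beta>")
        case True
        then have r: "1 \<le> g (fst b)" "\<phi> (g (fst b)) = fst b"
          using row[of "fst b" "snd b"] by simp_all
        then have "(g (fst b), snd b) \<in> boxes \<alpha>" using box\<phi>[OF r(1), of "snd b"] True by simp
        then show ?thesis using True r by simp
      qed (simp add: extensional_arb[OF ext])
    qed
  qed
qed

lemma weak_composition_flag_comp:
  assumes "flag \<phi>" "strict_mono_on {1..} \<phi>"
  shows "weak_composition (flag_comp \<alpha> \<phi>)"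
proof -
  have "\<phi> i \<noteq> 0" if "i \<ge> 1" for i
    using assms(1) that by (metis flag_def le_zero_eq not_one_le_zero)
  then show ?thesis
    unfolding weak_composition_def by (intro lookup_flag_comp(2)[OF assms(2)]) blast
qed

text \<open>A flag without equal neighbours increases at every step and hence strictly; so the least
  index in the theorem exists.\<close>

lemma ex_equal_adjacent:
  assumes "flag \<phi>" "\<not> strict_mono_on {1..} \<phi>"
  shows "\<exists>i\<ge>1. \<phi> i = \<phi> (i + 1)"
proof (rule ccontr)
  assume "\<not> ?thesis"
  then have step: "\<phi> i < \<phi> (Suc i)" if "1 \<le> i" for i
    using assms(1) that unfolding flag_def mono_on_def
    by (metis Suc_eq_plus1 atLeast_iff le_SucI le_neq_implies_less le_refl lessI less_imp_le)
  have "\<phi> i < \<phi> j" if "1 \<le> i" "i < j" for i j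
    using that(2)
  proof (induction j)
    case (Suc j)
    then show ?case using step[of i] step[of j] that(1) by (cases "i = j") auto
  qed simp
  then show False using assms(2) by (simp add: strict_mono_on_def)
qed

theorem theorem4p14:
  fixes \<alpha> :: comp and \<phi> :: "nat \<Rightarrow> nat"
  assumes "weak_composition \<alpha>" and "flag \<phi>"
  shows "(strict_mono_on {1..} \<phi> \<longrightarrow> flagged_key_poly \<alpha> \<phi> = key_poly (flag_comp \<alpha> \<phi>)) \<and>
    (\<forall>i. \<not> strict_mono_on {1..} \<phi> \<and> i = (LEAST i. i \<ge> 1 \<and> \<phi> i = \<phi> (i + 1)) \<longrightarrow>
       flagged_key_poly \<alpha> \<phi> =
         (if Poly_Mapping.lookup \<alpha> i \<le> Poly_Mapping.lookup \<alpha> (i + 1)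
          then flagged_key_poly \<alpha> (flag_minus_e \<phi> i)
          else flagged_key_poly (comp_act \<alpha> (simple_transp i)) (flag_minus_e \<phi> i)))"
proof (intro conjI impI allI)
  assume strict: "strict_mono_on {1..} \<phi>"
  show "flagged_key_poly \<alpha> \<phi> = key_poly (flag_comp \<alpha> \<phi>)"
    using flagged_key_poly_strict[OF assms strict]
      key_poly_eq_flagged_key_poly[OF weak_composition_flag_comp[OF assms(2) strict]] by simp
next
  fix i
  let ?A = "Poly_Mapping.lookup \<alpha>"
  assume i: "\<not> strict_mono_on {1..} \<phi> \<and> i = (LEAST i. i \<ge> 1 \<and> \<phi> i = \<phi> (i + 1))"
  have "1 \<le> i \<and> \<phi> i = \<phi> (i + 1)"
    unfolding conjunct2[OF i]
    by (rule LeastI_ex) (use ex_equal_adjacent[OF assms(2)] i in blast)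
  then have i1: "1 \<le> i" and eq: "\<phi> i = \<phi> (i + 1)" by auto
  show "flagged_key_poly \<alpha> \<phi> =
      (if ?A i \<le> ?A (i + 1) then flagged_key_poly \<alpha> (flag_minus_e \<phi> i)
       else flagged_key_poly (comp_act \<alpha> (simple_transp i)) (flag_minus_e \<phi> i))"
  proof (cases "?A i \<le> ?A (i + 1)")
    case True
    then show ?thesis using flagged_key_poly_decrease_flag[of \<alpha> i \<phi>] assms(1) i1 eq by simp
  next
    case False
    \<comment> \<open>Exchanging the rows first puts the shorter one at \<open>i\<close>, the case
      in which the flag can be lowered.\<close>
    let ?\<beta> = "comp_act \<alpha> (simple_transp i)"
    have "flagged_key_poly \<alpha> \<phi> = flagged_key_poly ?\<beta> \<phi>"
      by (rule flagged_key_poly_swap_rows[OF assms(1) i1 eq]) (use False in simp)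
    also have "\<dots> = flagged_key_poly ?\<beta> (flag_minus_e \<phi> i)"
      by (rule flagged_key_poly_decrease_flag)
        (use assms(1) i1 eq False in \<open>simp_all add: lookup_act_simple_transp simple_transp_apply\<close>)
    finally show ?thesis using False by simp
  qed
qed

end
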